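(* Let $\gamma>1$ and let $K$ be a kernel satisfying Assumption (K) (stated in the context) with exponent $\gamma$. Let $f_{\mathrm{in}}$ be a non-negative Radon measure on $(0,\infty)$ which is not a single Dirac measure, i.e. $f_{\mathrm{in}}$ is not of the form $M\delta_V$ with $M,V\in(0,\infty)$. Then there is no mass-conserving solution of the coagulation equation with kernel $K$ and initial datum $f_{\mathrm{in}}$ on any time interval $[0,T]$ with $T>0$.
   Context: Notation. $\mathscr{M}_+((0,\infty))$ is the set of non-negative Radon measures on $(0,\infty)$; for a measure $f$ one writes $f(v)\,dv$ even if it is not absolutely continuous. For $\beta>0$, $\mathscr{M}_+((0,\infty),1+v^\beta)$ is the set of $f\in\mathscr{M}_+((0,\infty))$ with $\int_{(0,\infty)}(1+v^\beta)f(v)\,dv<\infty$. $\delta_V$ is the unit Dirac mass at $V$. Assumption (K) (with exponent $\gamma>1$). The kernel $K:[0,\infty)\times[0,\infty)\to[0,\infty)$ has the form $K(v,v')=h(v,v')\,g\big(\tfrac{v}{v+v'}\big)$, where $g\in C([0,\infty))$ and $h\in C([0,\infty)^2)$ satisfy: (i) $h$ is symmetric, and there are $H>1$ and $H_0>0$ with $H_0(v^\gamma+v'^\gamma)\le h(v,v')$ whenever $v+v'>H$; (ii) for every $R>0$ there is $C_R>0$ with $h(v,v')\ge C_R$ for all $v,v'\in[\tfrac1R,R]$; (iii) there is $H_1>0$ with $h(v,v')\le H_1(v^\gamma+v'^\gamma)$ for all $v,v'\in[0,\infty)$; (iv) $g(x)=g(1-x)$ for $x\in[0,1]$, $g(\tfrac12)=0$,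 and there are $G_0,G_1>0$ and $k\ge1$ with $G_0|x-\tfrac12|^k\le g(x)\le G_1$ for all $x\in[0,1]$. The coagulation equation is $\partial_t f(v,t)=\frac12\int_{(0,v)}K(v-v',v')f(v-v',t)f(v',t)\,dv'-\int_{(0,\infty)}K(v,v')f(v,t)f(v',t)\,dv'$. Weak solution. Let $T\in(0,\infty]$ ($[0,T]$ means $[0,\infty)$ if $T=\infty$). A weak solution on $[0,T]$ with initial datum $f_{\mathrm{in}}$ is $f\in C([0,T];\mathscr{M}_+((0,\infty),1+v^\gamma))$ (continuity in time understood in the vague topology, i.e. tested against $C_c((0,\infty))$) such that $\sup_{t\in[0,T]}\int_{(0,\infty)}(1+v^\gamma)f(v,t)\,dv<\infty$ and, for every $\varphi\in C_c((0,\infty))$ and every $t\in[0,T]$, $$\int_{(0,\infty)}f(v,t)\varphi(v)\,dv-\int_{(0,\infty)}f_{\mathrm{in}}(v)\varphi(v)\,dv=\frac12\int_0^t\int_{(0,\infty)}\int_{(0,\infty)}K(v,v')\,[\varphi(v+v')-\varphi(v)-\varphi(v')]\,f(v,s)f(v',s)\,dv\,dv'\,ds.$$ Mass-conserving solution. For $T>0$, a mass-conserving solution on $[0,T]$ is a weak solution on $[0,T]$ with $\int_{(0,\infty)}v f(v,t)\,dv=\int_{(0,\infty)}v f_{\mathrm{in}}(v)\,dv$ for all $t\in[0,T]$.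
   Formalization: The initial datum is additionally assumed not to be the zero measure; for zero initial datum the zero function of time is a mass-conserving solution on every [0,T], so the claim fails there. *)

theory Defs
  imports "HOL-Probability.Probability"
begin

text \<open>Measures on \<open>(0,\<infinity>)\<close> have the half-line itself as underlying space, so unrestricted integrals
  against them are integrals over \<open>(0,\<infinity>)\<close>.\<close>

abbreviation borel_pos :: "real measure" where
  "borel_pos \<equiv> restrict_space borel {0<..}"

text \<open>Inner and outer regularity need not be demanded: on the \<open>\<sigma>\<close>-compact metric space \<open>(0,\<infinity>)\<close> they
  follow from finiteness on compact sets.\<close>

definition radon_pos :: "real measure \<Rightarrow> bool" where
  "radon_pos \<mu> \<longleftrightarrow> sets \<mu> = sets borel_pos \<and>
     (\<forall>S. compact S \<and> S \<subseteq> {0<..} \<longrightarrow> emeasure \<mu> S < \<infinity>)"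

definition radon_pos_weighted :: "real \<Rightarrow> real measure \<Rightarrow> bool" where
  "radon_pos_weighted \<beta> \<mu> \<longleftrightarrow> radon_pos \<mu> \<and> (\<integral>\<^sup>+v. ennreal (1 + v powr \<beta>) \<partial>\<mu>) < \<infinity>"

definition dirac_pos :: "real \<Rightarrow> real measure" where
  "dirac_pos V = return borel_pos V"

text \<open>The values of a test function outside \<open>(0,\<infinity>)\<close> are irrelevant.\<close>

definition Cc_pos :: "(real \<Rightarrow> real) set" where
  "Cc_pos = {\<phi>. continuous_on {0<..} \<phi> \<and>
     (\<exists>S. compact S \<and> S \<subseteq> {0<..} \<and> (\<forall>v\<in>{0<..} - S. \<phi> v = 0))}"

text \<open>At \<open>v = w = 0\<close> the argument of \<open>g\<close> is \<open>0 / 0 = 0\<close>. This is harmless: the bounds force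
  \<open>h 0 0 = 0\<close>, so the product vanishes there whatever the value of \<open>g\<close>. The exponent \<open>k\<close> is a real
  number, with \<open>0 powr k = 0\<close>.\<close>

definition kernel_assumption :: "real \<Rightarrow> (real \<Rightarrow> real \<Rightarrow> real) \<Rightarrow> bool" where
  "kernel_assumption \<gamma> K \<longleftrightarrow>
     (\<forall>v\<ge>0. \<forall>w\<ge>0. 0 \<le> K v w) \<and>
     (\<exists>h :: real \<Rightarrow> real \<Rightarrow> real. \<exists>g :: real \<Rightarrow> real.
        (\<forall>v\<ge>0. \<forall>w\<ge>0. K v w = h v w * g (v / (v + w))) \<and>
        continuous_on {0..} g \<and>
        continuous_on ({0..} \<times> {0..}) (\<lambda>(v, w). h v w) \<and>
        (\<forall>v\<ge>0. \<forall>w\<ge>0. h v w = h w v) \<and>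
        (\<exists>H>1. \<exists>H0>0. \<forall>v\<ge>0. \<forall>w\<ge>0. v + w > H \<longrightarrow> H0 * (v powr \<gamma> + w powr \<gamma>) \<le> h v w) \<and>
        (\<forall>R>0. \<exists>C>0. \<forall>v\<in>{1 / R..R}. \<forall>w\<in>{1 / R..R}. C \<le> h v w) \<and>
        (\<exists>H1>0. \<forall>v\<ge>0. \<forall>w\<ge>0. h v w \<le> H1 * (v powr \<gamma> + w powr \<gamma>)) \<and>
        (\<forall>x\<in>{0..1}. g x = g (1 - x)) \<and>
        g (1 / 2) = 0 \<and>
        (\<exists>G0>0. \<exists>G1>0. \<exists>k\<ge>1. \<forall>x\<in>{0..1}. G0 * \<bar>x - 1 / 2\<bar> powr k \<le> g x \<and> g x \<le> G1))"

text \<open>For \<open>T = \<infinity>\<close> this is \<open>[0,\<infinity>)\<close>.\<close>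

definition time_interval :: "ereal \<Rightarrow> real set" where
  "time_interval T = {t. 0 \<le> t \<and> ereal t \<le> T}"

text \<open>The Bochner integrals below are total, but no side condition is lost by not asking for
  integrability: if \<open>K\<close> satisfies \<open>kernel_assumption\<close> with exponent \<open>\<gamma>\<close>, then
  \<open>K v w \<le> C * (v powr \<gamma> + w powr \<gamma>)\<close> and the moment bound makes the inner double integral absolutely
  convergent and bounded in \<open>s\<close>; it is measurable in \<open>s\<close> by vague continuity.\<close>

definition weak_solution ::
  "real \<Rightarrow> (real \<Rightarrow> real \<Rightarrow> real) \<Rightarrow> ereal \<Rightarrow> real measure \<Rightarrow> (real \<Rightarrow> real measure) \<Rightarrow> bool" where
  "weak_solution \<gamma> K T f_in f \<longleftrightarrow>
     (\<forall>t\<in>time_interval T. radon_pos_weighted \<gamma> (f t)) \<and>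
     (\<forall>\<phi>\<in>Cc_pos. continuous_on (time_interval T) (\<lambda>t. \<integral>v. \<phi> v \<partial>f t)) \<and>
     (SUP t\<in>time_interval T. \<integral>\<^sup>+v. ennreal (1 + v powr \<gamma>) \<partial>f t) < \<infinity> \<and>
     (\<forall>\<phi>\<in>Cc_pos. \<forall>t\<in>time_interval T.
        (\<integral>v. \<phi> v \<partial>f t) - (\<integral>v. \<phi> v \<partial>f_in) =
        1 / 2 * (LINT s:{0..t}|lborel.
          (\<integral>w. (\<integral>v. K v w * (\<phi> (v + w) - \<phi> v - \<phi> w) \<partial>f s) \<partial>f s)))"

definition mass_conserving_solution ::
  "real \<Rightarrow> (real \<Rightarrow> real \<Rightarrow> real) \<Rightarrow> ereal \<Rightarrow> real measure \<Rightarrow> (real \<Rightarrow> real measure) \<Rightarrow> bool" where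
  "mass_conserving_solution \<gamma> K T f_in f \<longleftrightarrow>
     weak_solution \<gamma> K T f_in f \<and>
     (\<forall>t\<in>time_interval T. (\<integral>\<^sup>+v. ennreal v \<partial>f t) = (\<integral>\<^sup>+v. ennreal v \<partial>f_in))"

end

theory Submission imports Defs
begin

text \<open>Two consequences of the equation are incompatible, and both are drawn from the weak formulation
  and the uniform bound on the moment of order \<open>\<gamma>\<close>.

  Sizes become unbounded at once. A measure that is neither zero nor a single Dirac mass charges
  the neighbourhoods of two distinct sizes \<open>x < y\<close> (\<open>two_support_points\<close>). A size that is present
  stays present, because its loss rate is bounded (\<open>support_persists\<close>), and two distinct sizes that
  are present produce their sum immediately, because the kernel vanishes only on the diagonal
  (\<open>support_add\<close>). Hence every size \<open>y + n x\<close> is present at every positive time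
  (\<open>support_unbounded\<close>). A Dirac mass escapes this only because two equal clusters do not merge.

  Large clusters cannot be present. A cluster of size \<open>v\<close> absorbs the clusters of sizes in a fixed
  bounded window. Such a pair is far from the diagonal, so the kernel is at least \<open>\<kappa> v\<^sup>\<gamma>\<close>, and by
  persistence the window carries a moment bounded away from zero. So large clusters grow at least
  as fast as solutions of \<open>A' = c A\<^sup>\<gamma>\<close>, and since \<open>\<gamma> > 1\<close> these run from \<open>A\<close> to infinity within a
  time of order \<open>A\<^bsup>1 - \<gamma>\<^esup>\<close>, which is arbitrarily short for large \<open>A\<close>. In terms of measures, the
  excess of size beyond the threshold, a smoothed \<open>\<integral>(v - A)\<^sub>+ f(v) dv\<close>, cannot decrease while the
  threshold moves at that speed (\<open>advancing_front\<close>). When the threshold reaches infinity, the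
  bound on the moment of order \<open>\<gamma>\<close> forces the excess to zero (\<open>huber_moment_le\<close>), so it was zero
  from the start, against the unboundedness of the support (\<open>at_most_one_support_point\<close>).

  The threshold argument tests the equation with functions of linear growth. They are admissible
  because a Lipschitz \<open>\<phi>\<close> with \<open>\<phi> 0 = 0\<close> has \<open>\<bar>\<phi>(v + w) - \<phi> v - \<phi> w\<bar> \<le> 2 L min v w\<close>, and \<open>min v w\<close>
  times the growth \<open>v\<^sup>\<gamma> + w\<^sup>\<gamma>\<close> of the kernel is at most \<open>2 (1 + v\<^sup>\<gamma>) (1 + w\<^sup>\<gamma>)\<close>, whose double
  integral is bounded uniformly in time (\<open>abs_collision_le\<close>, \<open>weak_eq_lipschitz\<close>).\<close>

section \<open>Test functions\<close>

text \<open>Vanishing near \<open>0\<close> lets such a function be truncated to one with compact support in \<open>(0,\<infinity>)\<close>;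
  being nonnegative makes \<open>min \<phi> (n - v)\<^sub>+\<close> a truncation that keeps a Lipschitz constant
  independent of \<open>n\<close>.\<close>

definition test_function :: "real \<Rightarrow> (real \<Rightarrow> real) \<Rightarrow> bool" where
  "test_function L \<phi> \<longleftrightarrow>
     L-lipschitz_on UNIV \<phi> \<and> (\<forall>x. 0 \<le> \<phi> x) \<and> (\<exists>a>0. \<forall>x\<le>a. \<phi> x = 0)"

lemma test_functionD:
  assumes "test_function L \<phi>"
  shows "L-lipschitz_on UNIV \<phi>" "0 \<le> \<phi> x" "\<phi> 0 = 0" "0 \<le> L" "\<phi> \<in> borel_measurable borel"
proof -
  show "L-lipschitz_on UNIV \<phi>" using assms by (simp add: test_function_def)
  then show "0 \<le> L" "\<phi> \<in> borel_measurable borel"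
    by (auto dest: lipschitz_on_nonneg
        intro: borel_measurable_continuous_onI lipschitz_on_continuous_on)
  show "0 \<le> \<phi> x" "\<phi> 0 = 0" using assms by (auto simp: test_function_def)
qed

definition tent :: "real \<Rightarrow> real \<Rightarrow> real \<Rightarrow> real" where
  "tent x r v = max 0 (r - \<bar>v - x\<bar>)"

lemma tent_nonneg [simp]: "0 \<le> tent x r v"
  by (simp add: tent_def)

lemma tent_le [simp]: "0 \<le> r \<Longrightarrow> tent x r v \<le> r"
  by (simp add: tent_def)

lemma tent_eq_0: "v \<le> x - r \<or> x + r \<le> v \<Longrightarrow> tent x r v = 0"
  by (auto simp: tent_def)

lemma tent_le_self: "r \<le> x \<Longrightarrow> 0 \<le> v \<Longrightarrow> tent x r v \<le> v"
  by (auto simp: tent_def)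

lemma tent_lipschitz: "1-lipschitz_on UNIV (tent x r)"
  by (rule lipschitz_onI) (auto simp: tent_def dist_real_def)

lemma tent_test_function: "r < x \<Longrightarrow> test_function 1 (tent x r)"
  unfolding test_function_def using tent_lipschitz
  by (auto simp: tent_eq_0 intro!: exI[of _ "x - r"])

definition ramp :: "real \<Rightarrow> real \<Rightarrow> real" where
  "ramp A v = min 1 (max 0 (v - A))"

text \<open>The Huber function: quadratic on \<open>[A, A + 1]\<close> and affine of slope \<open>1\<close> beyond, so a convex
  smoothing of the positive part of \<open>v - A\<close> with derivative \<open>ramp A\<close>. The smoothing is there because
  the moment of the derivative must vary continuously in time and in \<open>A\<close>, which the mass of
  \<open>(A, \<infinity>)\<close> need not do.\<close>

definition huber :: "real \<Rightarrow> real \<Rightarrow> real" where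
  "huber A v = ramp A v * (v - A) - (ramp A v)\<^sup>2 / 2"

lemma ramp_bounds [simp]: "0 \<le> ramp A v" "ramp A v \<le> 1"
  by (auto simp: ramp_def)

lemma ramp_mono: "v \<le> w \<Longrightarrow> ramp A v \<le> ramp A w"
  by (auto simp: ramp_def)

lemma ramp_test_function: "0 < A \<Longrightarrow> test_function 1 (ramp A)"
  unfolding test_function_def
  by (auto simp: ramp_def dist_real_def intro!: lipschitz_onI exI[of _ A])

lemma huber_eq_0: "v \<le> A \<Longrightarrow> huber A v = 0"
  by (simp add: huber_def ramp_def)

lemma huber_eq: "A + 1 \<le> v \<Longrightarrow> huber A v = v - A - 1 / 2"
  by (simp add: huber_def ramp_def)

text \<open>The Huber function is the Legendre transform of \<open>a\<^sup>2 / 2\<close> on \<open>[0, 1]\<close>, evaluated at \<open>v - A\<close>, with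
  the maximum attained at \<open>a = ramp A v\<close>. This one inequality replaces case distinctions in
  everything that uses convexity.\<close>

lemma huber_Legendre:
  assumes "0 \<le> a" "a \<le> 1"
  shows "a * (v - A) - a\<^sup>2 / 2 \<le> huber A v"
proof -
  consider "v \<le> A" | "A \<le> v" "v \<le> A + 1" | "A + 1 \<le> v" by linarith
  then show ?thesis
  proof cases
    case 1
    then have "a * (v - A) \<le> 0" using assms by (simp add: mult_nonneg_nonpos)
    then show ?thesis using huber_eq_0[OF 1] zero_le_power2[of a] by linarith
  next
    case 2
    then have "huber A v = (v - A)\<^sup>2 / 2"
      by (simp add: huber_def ramp_def power2_eq_square)
    moreover have "0 \<le> (v - A - a)\<^sup>2" by simp
    ultimately show ?thesis by (simp add: power2_eq_square algebra_simps)
  next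
    case 3
    have "0 \<le> (1 - a) * (2 * (v - A) - (1 + a))" using assms 3 by (intro mult_nonneg_nonneg) auto
    then show ?thesis using huber_eq[OF 3] by (simp add: algebra_simps power2_eq_square)
  qed
qed

lemma huber_tangent: "huber A v + ramp A v * (w - v) \<le> huber A w"
  using huber_Legendre[of "ramp A v" w A] by (simp add: huber_def algebra_simps)

lemma huber_nonneg [simp]: "0 \<le> huber A v"
  using huber_Legendre[of 0 v A] by simp

lemma huber_lipschitz: "1-lipschitz_on UNIV (huber A)"
proof (rule lipschitz_on_leI)
  fix v w :: real assume "v \<le> w"
  then have "ramp A v * (w - v) \<le> 1 * (w - v)" "ramp A w * (w - v) \<le> 1 * (w - v)"
    "0 \<le> ramp A v * (w - v)"
    by (auto intro: mult_left_le_one_le)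
  then show "dist (huber A v) (huber A w) \<le> 1 * dist v w"
    using huber_tangent[of A v w] huber_tangent[of A w v] \<open>v \<le> w\<close>
    by (simp add: dist_real_def algebra_simps)
qed simp

lemma huber_test_function: "0 < A \<Longrightarrow> test_function 1 (huber A)"
  unfolding test_function_def using huber_lipschitz by (auto simp: huber_eq_0 intro!: exI[of _ A])

text \<open>A convex function that vanishes at \<open>0\<close> is superadditive on the half-line: the tangent at the
  larger summand has at least the slope of any chord from \<open>0\<close> to the smaller one.\<close>

lemma huber_superadditive:
  assumes "0 \<le> A" "0 \<le> v" "0 \<le> w"
  shows "huber A v + huber A w \<le> huber A (v + w)"
proof -
  have *: "huber A v + huber A w \<le> huber A (v + w)" if "0 \<le> w" "w \<le> v" for v w
  proof -
    have "huber A w \<le> ramp A w * w"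
      using huber_tangent[of A w 0] assms(1) by (simp add: huber_eq_0)
    also have "\<dots> \<le> ramp A v * w"
      using that by (intro mult_right_mono ramp_mono)
    finally show ?thesis using huber_tangent[of A v "v + w"] by simp
  qed
  show ?thesis
    using *[of w v] *[of v w] assms by (cases "w \<le> v") (auto simp: add.commute)
qed

text \<open>Moving the threshold from \<open>A\<close> to \<open>B\<close> translates the function by \<open>B - A\<close>, so by convexity
  it costs at most that distance times the derivative.\<close>

lemma huber_shift: "A \<le> B \<Longrightarrow> huber A v - (B - A) * ramp A v \<le> huber B v"
  using huber_tangent[of A v "v - (B - A)"] by (simp add: huber_def ramp_def algebra_simps)

lemma huber_le_powr:
  assumes "0 < A" "0 < v" "1 < p"
  shows "huber A v \<le> A powr (1 - p) * v powr p"
proof (cases "v \<le> A")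
  case True
  then show ?thesis by (simp add: huber_eq_0)
next
  case False
  have "huber A v \<le> ramp A v * (v - A)" by (simp add: huber_def)
  also have "\<dots> \<le> 1 * (v - A)" using False by (intro mult_right_mono) auto
  also have "\<dots> \<le> v powr (1 - p) * v powr p"
    using assms by (simp flip: powr_add)
  also have "\<dots> \<le> A powr (1 - p) * v powr p"
    using assms False by (intro mult_right_mono powr_mono2') auto
  finally show ?thesis .
qed

section \<open>Monotonicity on an interval\<close>

text \<open>The primitive \<open>Y r = \<integral>\<^sub>r\<^sup>t y\<close> satisfies \<open>- Y' \<le> c Y\<close>, so \<open>exp (c r) * Y r\<close> increases up to its
  value \<open>0\<close> at \<open>r = t\<close>; hence \<open>Y s \<le> 0\<close>, and the hypothesis gives \<open>y s \<le> 0\<close>.\<close>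

lemma backward_gronwall_zero:
  fixes y :: "real \<Rightarrow> real"
  assumes cont: "continuous_on {s..t} y" and st: "s \<le> t" and c: "0 \<le> c"
    and nn: "\<And>r. r \<in> {s..t} \<Longrightarrow> 0 \<le> y r"
    and le: "\<And>r. r \<in> {s..t} \<Longrightarrow> y r \<le> c * integral {r..t} y"
  shows "y s = 0"
proof -
  define Y where "Y r = integral {r..t} y" for r
  have dY: "(Y has_real_derivative - y r) (at r within {s..t})" if "r \<in> {s..t}" for r
    unfolding Y_def by (rule integral_has_real_derivative'[OF cont that])
  have "exp (c * s) * Y s \<le> exp (c * t) * Y t"
  proof (rule DERIV_nonneg_imp_increasing_open[OF st])
    fix r assume r: "s < r" "r < t"
    have "(Y has_real_derivative - y r) (at r)"
      using dY[of r] r by (simp add: at_within_Icc_at)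
    then have "((\<lambda>r. exp (c * r) * Y r) has_real_derivative exp (c * r) * (c * Y r - y r)) (at r)"
      by (auto intro!: derivative_eq_intros simp: algebra_simps)
    moreover have "0 \<le> exp (c * r) * (c * Y r - y r)"
      using le[of r] r by (simp add: Y_def)
    ultimately show "\<exists>d. ((\<lambda>r. exp (c * r) * Y r) has_real_derivative d) (at r) \<and> 0 \<le> d" by blast
  next
    have "continuous_on {s..t} Y"
      unfolding continuous_on_eq_continuous_within using DERIV_continuous[OF dY] by blast
    then show "continuous_on {s..t} (\<lambda>r. exp (c * r) * Y r)"
      by (intro continuous_intros)
  qed
  then have "Y s \<le> 0" by (simp add: Y_def mult_le_0_iff)
  then have "y s \<le> 0"
    using le[of s] st c mult_nonneg_nonpos[of c "Y s"] by (simp add: Y_def)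
  then show ?thesis using nn[of s] st by simp
qed

text \<open>Over \<open>n\<close> equal steps the losses add up to \<open>D (b - a)\<^sup>2 / n\<close>, which tends to \<open>0\<close>.\<close>

lemma nondecreasing_of_quadratic_defect:
  fixes G :: "real \<Rightarrow> real"
  assumes ab: "a \<le> b"
    and step: "\<And>t u. a \<le> t \<Longrightarrow> t \<le> u \<Longrightarrow> u \<le> b \<Longrightarrow> G t - D * (u - t)\<^sup>2 \<le> G u"
  shows "G a \<le> G b"
proof -
  have "G a - D * (b - a)\<^sup>2 * inverse (real (Suc n)) \<le> G b" for n
  proof -
    define h where "h = (b - a) / real (Suc n)"
    have h: "0 \<le> h" "real (Suc n) * h = b - a" using ab by (auto simp: h_def)
    have "G a - real k * (D * h\<^sup>2) \<le> G (a + real k * h)" if "k \<le> Suc n" for k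
      using that
    proof (induction k)
      case (Suc k)
      have "real (Suc k) * h \<le> real (Suc n) * h"
        using Suc.prems h(1) by (intro mult_right_mono) auto
      then have "G (a + real k * h) - D * h\<^sup>2 \<le> G (a + real (Suc k) * h)"
        using step[of "a + real k * h" "a + real (Suc k) * h"] h by (simp add: algebra_simps)
      then show ?case using Suc by (simp add: algebra_simps)
    qed simp
    from this[of "Suc n"] have "G a - real (Suc n) * (D * h\<^sup>2) \<le> G b" using h(2) by simp
    moreover have "real (Suc n) * (D * h\<^sup>2) = D * (real (Suc n) * h) * h"
      by (simp only: power2_eq_square mult_ac)
    then have "real (Suc n) * (D * h\<^sup>2) = D * (b - a)\<^sup>2 * inverse (real (Suc n))"
      unfolding h(2) by (simp add: h_def power2_eq_square divide_inverse)
    ultimately show ?thesis by linarith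
  qed
  moreover have "(\<lambda>n. G a - D * (b - a)\<^sup>2 * inverse (real (Suc n))) \<longlonglongrightarrow> G a - D * (b - a)\<^sup>2 * 0"
    by (intro tendsto_intros LIMSEQ_inverse_real_of_nat)
  ultimately show ?thesis
    by (intro LIMSEQ_le_const2[where X = "\<lambda>n. G a - D * (b - a)\<^sup>2 * inverse (real (Suc n))"]) auto
qed

section \<open>Integrals against measures with a bounded moment\<close>

text \<open>The consequences of the kernel assumption and of the definition of a weak solution that the
  argument works with. The measures are indexed by all real times, so that bounds and continuity hold
  without reference to the time interval; the equation itself is only required on \<open>[0,T]\<close>.\<close>

locale coagulation_flow =
  fixes \<gamma> C \<kappa> H M T :: real and K :: "real \<Rightarrow> real \<Rightarrow> real" and f :: "real \<Rightarrow> real measure"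
  assumes gamma: "1 < \<gamma>" and T_pos: "0 < T" and C_nonneg: "0 \<le> C" and M_pos: "0 < M"
    and K_measurable: "(\<lambda>z. K (fst z) (snd z)) \<in> borel_measurable (borel_pos \<Otimes>\<^sub>M borel_pos)"
    and K_nonneg: "\<And>v w. 0 < v \<Longrightarrow> 0 < w \<Longrightarrow> 0 \<le> K v w"
    and K_le: "\<And>v w. 0 < v \<Longrightarrow> 0 < w \<Longrightarrow> K v w \<le> C * (v powr \<gamma> + w powr \<gamma>)"
    and K_locally_positive: "\<And>x y. 0 < x \<Longrightarrow> 0 < y \<Longrightarrow> x \<noteq> y \<Longrightarrow> \<exists>\<rho>>0. \<exists>c>0. \<rho> < x \<and> \<rho> < y \<and>
        (\<forall>v\<in>{x - \<rho>..x + \<rho>}. \<forall>w\<in>{y - \<rho>..y + \<rho>}. c \<le> K v w)"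
    and kappa_pos: "0 < \<kappa>" and H_pos: "0 < H"
    and K_ge: "\<And>v w. H \<le> v \<Longrightarrow> 0 < w \<Longrightarrow> 3 * w \<le> v \<Longrightarrow> \<kappa> * v powr \<gamma> \<le> K v w"
    and sets_f [measurable_cong]: "\<And>t. sets (f t) = sets borel_pos"
    and moment: "\<And>t. (\<integral>\<^sup>+v. ennreal (1 + v powr \<gamma>) \<partial>f t) \<le> ennreal M"
    and vague_continuous: "\<And>\<phi>. \<phi> \<in> Cc_pos \<Longrightarrow> continuous_on UNIV (\<lambda>t. \<integral>v. \<phi> v \<partial>f t)"
    and weak_eq: "\<And>\<phi> t. \<phi> \<in> Cc_pos \<Longrightarrow> t \<in> {0..T} \<Longrightarrow>
        (\<integral>v. \<phi> v \<partial>f t) - (\<integral>v. \<phi> v \<partial>f 0) =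
        1 / 2 * (LINT s:{0..t}|lborel.
          (\<integral>w. (\<integral>v. K v w * (\<phi> (v + w) - \<phi> v - \<phi> w) \<partial>f s) \<partial>f s))"
begin

lemma space_f [simp]: "space (f t) = {0<..}"
  using sets_eq_imp_space_eq[OF sets_f[of t]] by (simp add: space_restrict_space)

lemma space_pair_f [simp]: "space (f t \<Otimes>\<^sub>M f t) = {0<..} \<times> {0<..}"
  by (simp add: space_pair_measure)

lemma borel_measurable_f:
  assumes "\<psi> \<in> borel_measurable borel" shows "\<psi> \<in> borel_measurable (f t)"
  using measurable_restrict_space1[OF assms, of "{0<..}"]
  by (simp add: measurable_cong_sets[OF sets_f refl])

lemma fst_measurable_pair [measurable]: "fst \<in> borel_measurable (f t \<Otimes>\<^sub>M f t)"
  using measurable_compose[OF measurable_fst borel_measurable_f[of "\<lambda>x. x" t]] by simp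

lemma snd_measurable_pair [measurable]: "snd \<in> borel_measurable (f t \<Otimes>\<^sub>M f t)"
  using measurable_compose[OF measurable_snd borel_measurable_f[of "\<lambda>x. x" t]] by simp

lemma K_measurable_pair [measurable]:
  "(\<lambda>z. K (fst z) (snd z)) \<in> borel_measurable (f t \<Otimes>\<^sub>M f t)"
  using K_measurable
  by (simp add: measurable_cong_sets[OF sets_pair_measure_cong[OF sets_f[of t] sets_f[of t]] refl])

lemma weight_integrable: "integrable (f t) (\<lambda>v. 1 + v powr \<gamma>)"
  and weight_integral: "(\<integral>v. 1 + v powr \<gamma> \<partial>f t) \<le> M"
proof -
  have [measurable]: "(\<lambda>v. 1 + v powr \<gamma>) \<in> borel_measurable (f t)"
    by (rule borel_measurable_f) measurable
  show I: "integrable (f t) (\<lambda>v. 1 + v powr \<gamma>)"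
    using moment[of t] by (intro integrableI_nonneg) (auto intro: le_less_trans)
  have "ennreal (\<integral>v. 1 + v powr \<gamma> \<partial>f t) \<le> ennreal M"
    using moment[of t] I by (subst nn_integral_eq_integral[symmetric]) auto
  then show "(\<integral>v. 1 + v powr \<gamma> \<partial>f t) \<le> M"
    using M_pos by simp
qed

lemma total_mass_le: "emeasure (f t) {0<..} \<le> ennreal M"
proof -
  have "emeasure (f t) {0<..} = (\<integral>\<^sup>+v. 1 \<partial>f t)" by simp
  also have "\<dots> \<le> (\<integral>\<^sup>+v. ennreal (1 + v powr \<gamma>) \<partial>f t)"
    by (intro nn_integral_mono) (simp flip: ennreal_1)
  also have "\<dots> \<le> ennreal M" by (rule moment)
  finally show ?thesis .
qed

lemma finite_f: "finite_measure (f t)"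
proof
  show "emeasure (f t) (space (f t)) \<noteq> \<infinity>"
    using total_mass_le[of t] by (auto simp: top_unique)
qed

lemma pair_sigma_finite_f: "pair_sigma_finite (f t) (f t)"
proof -
  interpret finite_measure "f t" by (rule finite_f)
  show ?thesis ..
qed

lemma integrable_weighted:
  assumes "\<psi> \<in> borel_measurable borel" "\<And>v. 0 < v \<Longrightarrow> \<bar>\<psi> v\<bar> \<le> B * (1 + v powr \<gamma>)"
  shows "integrable (f t) \<psi>"
proof (rule Bochner_Integration.integrable_bound)
  show "integrable (f t) (\<lambda>v. B * (1 + v powr \<gamma>))"
    by (intro integrable_mult_right weight_integrable)
  show "AE v in f t. norm (\<psi> v) \<le> norm (B * (1 + v powr \<gamma>))"
    using assms(2) by (intro AE_I2) (force intro: order_trans[OF _ abs_ge_self])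
qed (rule borel_measurable_f[OF assms(1)])

lemma abs_integral_weighted:
  assumes "\<psi> \<in> borel_measurable borel" "\<And>v. 0 < v \<Longrightarrow> \<bar>\<psi> v\<bar> \<le> B * (1 + v powr \<gamma>)"
  shows "\<bar>\<integral>v. \<psi> v \<partial>f t\<bar> \<le> B * M"
proof -
  have "0 \<le> \<bar>\<psi> 1\<bar>" by simp
  also have "\<dots> \<le> B * 2" using assms(2)[of 1] by simp
  finally have B: "0 \<le> B" by simp
  have "\<bar>\<integral>v. \<psi> v \<partial>f t\<bar> \<le> (\<integral>v. \<bar>\<psi> v\<bar> \<partial>f t)"
    using integral_norm_bound[of "f t" \<psi>] by simp
  also have "\<dots> \<le> (\<integral>v. B * (1 + v powr \<gamma>) \<partial>f t)"
    using assms(2)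
    by (intro integral_mono integrable_abs integrable_weighted[OF assms]
        integrable_mult_right weight_integrable) simp_all
  also have "\<dots> \<le> B * M"
    using B weight_integral by (simp add: mult_left_mono)
  finally show ?thesis .
qed

lemma pair_integral_product:
  fixes \<psi> \<eta> :: "real \<Rightarrow> real"
  assumes "integrable (f t) \<psi>" "integrable (f t) \<eta>"
  shows "integrable (f t \<Otimes>\<^sub>M f t) (\<lambda>z. \<psi> (fst z) * \<eta> (snd z))"
    and "(\<integral>z. \<psi> (fst z) * \<eta> (snd z) \<partial>(f t \<Otimes>\<^sub>M f t)) = (\<integral>v. \<psi> v \<partial>f t) * (\<integral>v. \<eta> v \<partial>f t)"
proof -
  interpret pair_sigma_finite "f t" "f t" by (rule pair_sigma_finite_f)
  have [measurable]: "\<psi> \<in> borel_measurable (f t)" "\<eta> \<in> borel_measurable (f t)"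
    using assms by auto
  show I: "integrable (f t \<Otimes>\<^sub>M f t) (\<lambda>z. \<psi> (fst z) * \<eta> (snd z))"
    by (intro Fubini_integrable) (use assms in \<open>auto simp: abs_mult\<close>)
  show "(\<integral>z. \<psi> (fst z) * \<eta> (snd z) \<partial>(f t \<Otimes>\<^sub>M f t)) = (\<integral>v. \<psi> v \<partial>f t) * (\<integral>v. \<eta> v \<partial>f t)"
    using integral_fst'[OF I] by simp
qed

lemma pair_integrable_weighted:
  assumes "\<Psi> \<in> borel_measurable (f t \<Otimes>\<^sub>M f t)"
    and "\<And>v w. 0 < v \<Longrightarrow> 0 < w \<Longrightarrow> \<bar>\<Psi> (v, w)\<bar> \<le> B * ((1 + v powr \<gamma>) * (1 + w powr \<gamma>))"
  shows "integrable (f t \<Otimes>\<^sub>M f t) \<Psi>"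
proof (rule Bochner_Integration.integrable_bound)
  show "integrable (f t \<Otimes>\<^sub>M f t) (\<lambda>z. B * ((1 + fst z powr \<gamma>) * (1 + snd z powr \<gamma>)))"
    by (intro integrable_mult_right pair_integral_product(1) weight_integrable)
  show "AE z in f t \<Otimes>\<^sub>M f t. norm (\<Psi> z) \<le> norm (B * ((1 + fst z powr \<gamma>) * (1 + snd z powr \<gamma>)))"
    using assms(2) by (intro AE_I2) (force intro: order_trans[OF _ abs_ge_self])
qed (rule assms(1))

lemma abs_pair_integral_weighted:
  assumes "\<Psi> \<in> borel_measurable (f t \<Otimes>\<^sub>M f t)"
    and "\<And>v w. 0 < v \<Longrightarrow> 0 < w \<Longrightarrow> \<bar>\<Psi> (v, w)\<bar> \<le> B * ((1 + v powr \<gamma>) * (1 + w powr \<gamma>))"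
  shows "\<bar>\<integral>z. \<Psi> z \<partial>(f t \<Otimes>\<^sub>M f t)\<bar> \<le> B * M\<^sup>2"
proof -
  have "0 \<le> \<bar>\<Psi> (1, 1)\<bar>" by simp
  also have "\<dots> \<le> B * 4" using assms(2)[of 1 1] by simp
  finally have B: "0 \<le> B" by simp
  have "0 \<le> (\<integral>v. 1 + v powr \<gamma> \<partial>f t)" by (rule Bochner_Integration.integral_nonneg) simp
  then have W2: "(\<integral>v. 1 + v powr \<gamma> \<partial>f t) * (\<integral>v. 1 + v powr \<gamma> \<partial>f t) \<le> M * M"
    using weight_integral M_pos by (intro mult_mono) auto
  have "\<bar>\<integral>z. \<Psi> z \<partial>(f t \<Otimes>\<^sub>M f t)\<bar> \<le> (\<integral>z. \<bar>\<Psi> z\<bar> \<partial>(f t \<Otimes>\<^sub>M f t))"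
    using integral_norm_bound[of "f t \<Otimes>\<^sub>M f t" \<Psi>] by simp
  also have "\<dots> \<le> (\<integral>z. B * ((1 + fst z powr \<gamma>) * (1 + snd z powr \<gamma>)) \<partial>(f t \<Otimes>\<^sub>M f t))"
    using assms(2)
    by (intro integral_mono integrable_abs pair_integrable_weighted[OF assms]
        integrable_mult_right pair_integral_product(1) weight_integrable) auto
  also have "\<dots> \<le> B * M\<^sup>2"
    using B W2 pair_integral_product(2)[OF weight_integrable weight_integrable, of t]
    by (simp add: mult_left_mono power2_eq_square)
  finally show ?thesis .
qed

lemma le_weight: "0 < v \<Longrightarrow> v \<le> 1 + v powr \<gamma>"
  using gamma powr_mono[of 1 \<gamma> v] by (cases "v \<le> 1") (auto simp: add_increasing2)

text \<open>The smaller of the two sizes can always be paired with the power of the other one, so no moment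
  of order above \<open>\<gamma>\<close> is needed.\<close>

lemma min_powr_le: assumes "0 < v" "0 < w"
  shows "(v powr \<gamma> + w powr \<gamma>) * min v w \<le> 2 * ((1 + v powr \<gamma>) * (1 + w powr \<gamma>))"
proof -
  have "v powr \<gamma> * min v w \<le> (1 + v powr \<gamma>) * (1 + w powr \<gamma>)"
    using le_weight[of w] assms by (intro mult_mono) auto
  moreover have "w powr \<gamma> * min v w \<le> (1 + w powr \<gamma>) * (1 + v powr \<gamma>)"
    using le_weight[of v] assms by (intro mult_mono) auto
  ultimately show ?thesis by (simp add: algebra_simps)
qed

definition collision :: "(real \<Rightarrow> real) \<Rightarrow> real \<times> real \<Rightarrow> real" where
  "collision \<phi> z = K (fst z) (snd z) * (\<phi> (fst z + snd z) - \<phi> (fst z) - \<phi> (snd z))"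

definition rate :: "(real \<Rightarrow> real) \<Rightarrow> real \<Rightarrow> real" where
  "rate \<phi> t = (\<integral>z. collision \<phi> z \<partial>(f t \<Otimes>\<^sub>M f t))"

lemma collision_measurable [measurable]:
  assumes [measurable]: "\<phi> \<in> borel_measurable borel"
  shows "collision \<phi> \<in> borel_measurable (f t \<Otimes>\<^sub>M f t)"
  unfolding collision_def by measurable

lemma abs_collision_le:
  assumes lip: "L-lipschitz_on UNIV \<phi>" and "\<phi> 0 = 0" and pos: "0 < v" "0 < w"
  shows "\<bar>collision \<phi> (v, w)\<bar> \<le> 4 * L * C * ((1 + v powr \<gamma>) * (1 + w powr \<gamma>))"
proof -
  have L: "0 \<le> L" by (rule lipschitz_on_nonneg[OF lip])
  have *: "\<bar>\<phi> x - \<phi> y\<bar> \<le> L * \<bar>x - y\<bar>" for x y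
    using lipschitz_onD[OF lip, of x y] by (simp add: dist_real_def)
  have a: "\<bar>\<phi> (v + w) - \<phi> v\<bar> \<le> L * w" "\<bar>\<phi> (v + w) - \<phi> w\<bar> \<le> L * v"
    "\<bar>\<phi> w\<bar> \<le> L * w" "\<bar>\<phi> v\<bar> \<le> L * v"
    using *[of "v + w" v] *[of "v + w" w] *[of v 0] *[of w 0] pos assms(2) by auto
  have "\<bar>\<phi> (v + w) - \<phi> v - \<phi> w\<bar> \<le> 2 * L * min v w"
    using a by (auto simp: min_def)
  then have "\<bar>collision \<phi> (v, w)\<bar> \<le> (C * (v powr \<gamma> + w powr \<gamma>)) * (2 * L * min v w)"
    unfolding collision_def abs_mult fst_conv snd_conv
    using K_nonneg[OF pos] K_le[OF pos] by (intro mult_mono) auto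
  also have "\<dots> = 2 * L * C * ((v powr \<gamma> + w powr \<gamma>) * min v w)" by simp
  also have "\<dots> \<le> 2 * L * C * (2 * ((1 + v powr \<gamma>) * (1 + w powr \<gamma>)))"
    using min_powr_le[OF pos] L C_nonneg by (intro mult_left_mono) auto
  finally show ?thesis by simp
qed

end

section \<open>The weak equation for Lipschitz test functions\<close>

lemma eventually_le_real: "\<forall>\<^sub>F n in sequentially. c \<le> real n"
  by (rule eventually_sequentiallyI[of "nat \<lceil>c\<rceil>"]) linarith

context coagulation_flow begin

text \<open>The indicator of an open set is a pointwise limit of functions in \<open>Cc_pos\<close>, whose integrals are
  continuous in time.\<close>

lemma emeasure_open_time_measurable:
  assumes S: "open S" "S \<subseteq> {0<..}"
  shows "(\<lambda>t. emeasure (f t) S) \<in> borel_measurable borel"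
proof -
  define \<phi> where "\<phi> n x = min 1 (max 0 (real n * infdist x (- S) - 1)) * min 1 (max 0 (real n + 1 - x))"
    for n x
  have S0: "0 \<in> - S" and clS: "closed (- S)" using S by auto
  have cont: "continuous_on X (\<phi> n)" for X n
    unfolding \<phi>_def by (intro continuous_intros)
  have Cc: "\<phi> n \<in> Cc_pos" for n
  proof -
    have "\<phi> n x = 0" if "0 < x" "x \<notin> {1 / (real n + 1)..real n + 1}" for x
    proof (cases "x \<le> real n + 1")
      case True
      have "real n * infdist x (- S) \<le> real n * x"
        using infdist_le[OF S0, of x] that(1) by (intro mult_left_mono) (auto simp: dist_real_def)
      also have "\<dots> \<le> (real n + 1) * x" using that(1) by (simp add: algebra_simps)
      also have "\<dots> \<le> 1" using that True by (auto simp: field_simps)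
      finally show ?thesis by (simp add: \<phi>_def)
    qed (simp add: \<phi>_def)
    moreover have "compact {1 / (real n + 1)..real n + 1}" "{1 / (real n + 1)..real n + 1} \<subseteq> {0<..}"
      by (auto intro: less_le_trans[of 0 "1 / (real n + 1)"])
    ultimately show ?thesis
      unfolding Cc_pos_def using cont by blast
  qed
  have lim: "(\<lambda>n. \<phi> n x) \<longlonglongrightarrow> indicator S x" for x
  proof (cases "x \<in> S")
    case True
    then have d: "0 < infdist x (- S)"
      using S0 clS infdist_pos_not_in_closed[of "- S" x] by auto
    have "\<forall>\<^sub>F n in sequentially. 2 / infdist x (- S) \<le> real n \<and> \<bar>x\<bar> \<le> real n"
      by (intro eventually_conj eventually_le_real)
    then have "\<forall>\<^sub>F n in sequentially. \<phi> n x = indicator S x"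
    proof eventually_elim
      case (elim n)
      then have "2 \<le> real n * infdist x (- S)" using d by (simp add: field_simps)
      then show ?case using elim True by (auto simp: \<phi>_def)
    qed
    then show ?thesis by (rule tendsto_eventually)
  next
    case False
    then show ?thesis by (simp add: \<phi>_def)
  qed
  have meas [measurable]: "\<phi> n \<in> borel_measurable (f t)" for n t
    by (intro borel_measurable_f borel_measurable_continuous_onI cont)
  have SetS: "S \<in> sets (f t)" for t
    using S by (simp add: sets_f sets_restrict_space_iff)
  have "(\<lambda>n. \<integral>v. \<phi> n v \<partial>f t) \<longlonglongrightarrow> (\<integral>v. indicator S v \<partial>f t)" for t
  proof (rule integral_dominated_convergence)
    interpret finite_measure "f t" by (rule finite_f)
    show "integrable (f t) (\<lambda>_. 1 :: real)" by simp
    show "indicat_real S \<in> borel_measurable (f t)" using SetS by simp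
    show "AE v in f t. norm (\<phi> n v) \<le> 1" for n
      by (intro AE_I2) (auto simp: \<phi>_def abs_mult intro!: mult_le_one)
  qed (use lim in auto)
  moreover have "(\<integral>v. indicator S v \<partial>f t) = measure (f t) S" for t
    using SetS S by (simp add: Int_absorb2)
  ultimately have tends: "(\<lambda>n. \<integral>v. \<phi> n v \<partial>f t) \<longlonglongrightarrow> measure (f t) S" for t by simp
  have "(\<lambda>t. measure (f t) S) \<in> borel_measurable borel"
  proof (rule borel_measurable_LIMSEQ_real)
    show "(\<lambda>n. \<integral>v. \<phi> n v \<partial>f t) \<longlonglongrightarrow> measure (f t) S" for t by (rule tends)
    show "(\<lambda>t. \<integral>v. \<phi> n v \<partial>f t) \<in> borel_measurable borel" for n
      by (rule borel_measurable_continuous_onI[OF vague_continuous[OF Cc]])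
  qed
  moreover have "emeasure (f t) S = ennreal (measure (f t) S)" for t
    by (rule finite_measure.emeasure_eq_measure[OF finite_f])
  ultimately show ?thesis by simp
qed

text \<open>Normalising the total mass turns the flow into a subprobability kernel, for which the measurability
  of parametrised integrals is available.\<close>

lemma time_kernel_measurable:
  "(\<lambda>t. scale_measure (ennreal (1 / M)) (f t)) \<in> measurable borel (subprob_algebra borel_pos)"
proof (rule measurable_subprob_algebra_generated)
  have "{0<..} \<in> sigma_sets UNIV {S :: real set. open S}"
    by (rule sigma_sets.Basic) simp
  moreover have "sets (borel :: real measure) = sigma_sets UNIV {S. open S}"
    unfolding borel_def by (rule sets_measure_of) simp
  ultimately show "sets borel_pos = sigma_sets {0<..} ((\<inter>) {0<..} ` {S :: real set. open S})"
    using sigma_sets_Int[of "{0<..} :: real set" UNIV "{S. open S}"]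
    by (simp add: sets_restrict_space)
  show "Int_stable ((\<inter>) {0<..} ` {S :: real set. open S})"
  proof (rule Int_stableI)
    fix A B :: "real set"
    assume "A \<in> (\<inter>) {0<..} ` {S. open S}" "B \<in> (\<inter>) {0<..} ` {S. open S}"
    then obtain S S' where "A = {0<..} \<inter> S" "B = {0<..} \<inter> S'" "open S" "open S'" by auto
    then have "A \<inter> B = {0<..} \<inter> (S \<inter> S')" "open (S \<inter> S')" by auto
    then show "A \<inter> B \<in> (\<inter>) {0<..} ` {S. open S}" by blast
  qed
  have "ennreal (1 / M) * emeasure (f t) {0<..} \<le> ennreal (1 / M) * ennreal M" for t
    by (intro mult_left_mono total_mass_le) simp
  then have "ennreal (1 / M) * emeasure (f t) {0<..} \<le> 1" for t
    using M_pos by (simp flip: ennreal_mult)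
  then show "subprob_space (scale_measure (ennreal (1 / M)) (f t))" for t
    by (intro subprob_spaceI) (auto simp: space_scale_measure)
  show "(\<lambda>t. emeasure (scale_measure (ennreal (1 / M)) (f t)) A) \<in> borel_measurable borel"
    if "A \<in> (\<inter>) {0<..} ` {S :: real set. open S}" for A
    using that by (auto intro!: borel_measurable_times_ennreal emeasure_open_time_measurable)
  show "(\<lambda>t. emeasure (scale_measure (ennreal (1 / M)) (f t)) {0<..}) \<in> borel_measurable borel"
    by (auto intro!: borel_measurable_times_ennreal emeasure_open_time_measurable)
qed (auto simp: sets_f)

lemma nn_integral_scaled:
  assumes "g \<in> borel_measurable (f t)"
  shows "(\<integral>\<^sup>+v. g v \<partial>f t) = ennreal M * (\<integral>\<^sup>+v. g v \<partial>scale_measure (ennreal (1 / M)) (f t))"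
  using M_pos assms
  by (simp add: nn_integral_scale_measure mult.assoc[symmetric] flip: ennreal_mult)

lemma pair_nn_integral_time_measurable:
  assumes [measurable]: "\<Psi> \<in> borel_measurable (borel_pos \<Otimes>\<^sub>M borel_pos)"
  shows "(\<lambda>t. \<integral>\<^sup>+z. \<Psi> z \<partial>(f t \<Otimes>\<^sub>M f t)) \<in> borel_measurable borel"
proof -
  define N where "N t = scale_measure (ennreal (1 / M)) (f t)" for t
  have N [measurable]: "N \<in> measurable borel (subprob_algebra borel_pos)"
    unfolding N_def by (rule time_kernel_measurable)
  have m [measurable]: "\<Psi> \<in> borel_measurable (f t \<Otimes>\<^sub>M f t)" for t
    using assms by (simp add: measurable_cong_sets[OF sets_pair_measure_cong[OF sets_f[of t] sets_f[of t]] refl])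
  have eq: "(\<integral>\<^sup>+z. \<Psi> z \<partial>(f t \<Otimes>\<^sub>M f t))
      = ennreal M * (\<integral>\<^sup>+w. ennreal M * (\<integral>\<^sup>+v. \<Psi> (v, w) \<partial>N t) \<partial>N t)" for t
  proof -
    interpret pair_sigma_finite "f t" "f t" by (rule pair_sigma_finite_f)
    have "(\<integral>\<^sup>+z. \<Psi> z \<partial>(f t \<Otimes>\<^sub>M f t)) = (\<integral>\<^sup>+w. (\<integral>\<^sup>+v. \<Psi> (v, w) \<partial>f t) \<partial>f t)"
      by (rule nn_integral_snd[symmetric]) measurable
    also have "\<dots> = ennreal M * (\<integral>\<^sup>+w. (\<integral>\<^sup>+v. \<Psi> (v, w) \<partial>f t) \<partial>N t)"
      unfolding N_def by (rule nn_integral_scaled) measurable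
    also have "(\<integral>\<^sup>+w. (\<integral>\<^sup>+v. \<Psi> (v, w) \<partial>f t) \<partial>N t) = (\<integral>\<^sup>+w. ennreal M * (\<integral>\<^sup>+v. \<Psi> (v, w) \<partial>N t) \<partial>N t)"
      unfolding N_def
      by (intro nn_integral_cong nn_integral_scaled) (auto simp: space_scale_measure)
    finally show ?thesis .
  qed
  have "(\<lambda>p. \<integral>\<^sup>+v. \<Psi> (v, snd p) \<partial>N (fst p)) \<in> borel_measurable (borel \<Otimes>\<^sub>M borel_pos)"
    by (rule nn_integral_measurable_subprob_algebra2[where N = borel_pos]) measurable
  then have "(\<lambda>t. \<integral>\<^sup>+w. ennreal M * (\<integral>\<^sup>+v. \<Psi> (v, w) \<partial>N t) \<partial>N t) \<in> borel_measurable borel"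
    by (intro nn_integral_measurable_subprob_algebra2[where N = borel_pos])
      (auto simp: split_beta' intro!: borel_measurable_times_ennreal)
  then show ?thesis
    unfolding eq by (intro borel_measurable_times_ennreal) auto
qed

lemma abs_rate_le:
  assumes "L-lipschitz_on UNIV \<phi>" "\<phi> 0 = 0"
  shows "\<bar>rate \<phi> t\<bar> \<le> 4 * L * C * M\<^sup>2"
  unfolding rate_def
  by (intro abs_pair_integral_weighted collision_measurable abs_collision_le[OF assms]
      borel_measurable_continuous_onI lipschitz_on_continuous_on[OF assms(1)])

lemma collision_integrable:
  assumes "L-lipschitz_on UNIV \<phi>" "\<phi> 0 = 0"
  shows "integrable (f t \<Otimes>\<^sub>M f t) (collision \<phi>)"
  by (rule pair_integrable_weighted[where B = "4 * L * C"])
    (intro collision_measurable abs_collision_le[OF assms]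
      borel_measurable_continuous_onI lipschitz_on_continuous_on[OF assms(1)])+

lemma rate_measurable:
  assumes "L-lipschitz_on UNIV \<phi>" "\<phi> 0 = 0"
  shows "rate \<phi> \<in> borel_measurable borel"
proof -
  have m [measurable]: "\<phi> \<in> borel_measurable borel"
    by (intro borel_measurable_continuous_onI lipschitz_on_continuous_on[OF assms(1)])
  have [measurable]: "fst \<in> borel_measurable (borel_pos \<Otimes>\<^sub>M borel_pos)"
    "snd \<in> borel_measurable (borel_pos \<Otimes>\<^sub>M borel_pos)"
    using measurable_compose[OF measurable_fst measurable_restrict_space1[of "\<lambda>x. x :: real" borel borel "{0<..}"]]
      measurable_compose[OF measurable_snd measurable_restrict_space1[of "\<lambda>x. x :: real" borel borel "{0<..}"]]
    by auto
  note K_measurable [measurable]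
  have [measurable]: "collision \<phi> \<in> borel_measurable (borel_pos \<Otimes>\<^sub>M borel_pos)"
    unfolding collision_def by measurable
  have "rate \<phi> t = enn2real (\<integral>\<^sup>+z. ennreal (collision \<phi> z) \<partial>(f t \<Otimes>\<^sub>M f t))
      - enn2real (\<integral>\<^sup>+z. ennreal (- collision \<phi> z) \<partial>(f t \<Otimes>\<^sub>M f t))" for t
    unfolding rate_def by (rule real_lebesgue_integral_def[OF collision_integrable[OF assms]])
  moreover have "(\<lambda>t. enn2real (\<integral>\<^sup>+z. ennreal (collision \<phi> z) \<partial>(f t \<Otimes>\<^sub>M f t))
      - enn2real (\<integral>\<^sup>+z. ennreal (- collision \<phi> z) \<partial>(f t \<Otimes>\<^sub>M f t))) \<in> borel_measurable borel"
    by (intro borel_measurable_diff borel_measurable_enn2real pair_nn_integral_time_measurable) measurable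
  ultimately show ?thesis by presburger
qed

lemma rate_set_integrable:
  assumes "L-lipschitz_on UNIV \<phi>" "\<phi> 0 = 0"
  shows "set_integrable lborel {s..t} (rate \<phi>)"
  unfolding set_integrable_def
proof (rule Bochner_Integration.integrable_bound)
  show "integrable lborel (\<lambda>r. indicator {s..t} r *\<^sub>R (4 * L * C * M\<^sup>2))"
    by (intro integrable_scaleR_left integrable_real_indicator) (auto simp: emeasure_lborel_Icc_eq)
  show "(\<lambda>r. indicat_real {s..t} r *\<^sub>R rate \<phi> r) \<in> borel_measurable lborel"
    using rate_measurable[OF assms] by simp
  show "AE r in lborel. norm (indicat_real {s..t} r *\<^sub>R rate \<phi> r)
      \<le> norm (indicator {s..t} r *\<^sub>R (4 * L * C * M\<^sup>2))"
    using abs_rate_le[OF assms] by (intro AE_I2) (auto simp: indicator_def intro: order_trans[OF _ abs_ge_self])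
qed

lemma weak_eq_compact_support:
  assumes lip: "L-lipschitz_on UNIV \<phi>" and "0 < a" "\<And>x. x \<le> a \<Longrightarrow> \<phi> x = 0" "\<And>x. b \<le> x \<Longrightarrow> \<phi> x = 0"
    and t: "0 \<le> t" "t \<le> T"
  shows "(\<integral>v. \<phi> v \<partial>f t) - (\<integral>v. \<phi> v \<partial>f 0) = 1 / 2 * (LINT s:{0..t}|lborel. rate \<phi> s)"
proof -
  have "\<phi> \<in> Cc_pos"
    unfolding Cc_pos_def using assms
    by (auto intro!: exI[of _ "{a..b}"] continuous_on_subset[OF lipschitz_on_continuous_on[OF lip]])
  moreover have "(\<integral>w. (\<integral>v. K v w * (\<phi> (v + w) - \<phi> v - \<phi> w) \<partial>f s) \<partial>f s) = rate \<phi> s" for s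
  proof -
    interpret pair_sigma_finite "f s" "f s" by (rule pair_sigma_finite_f)
    have "integrable (f s \<Otimes>\<^sub>M f s) (\<lambda>(v, w). collision \<phi> (v, w))"
      using collision_integrable[OF lip, of s] assms by simp
    from integral_snd[OF this] show ?thesis
      by (simp add: rate_def collision_def split_beta')
  qed
  ultimately show ?thesis using weak_eq[of \<phi> t] t by simp
qed

lemma lipschitz_integrable:
  fixes \<phi> :: "real \<Rightarrow> real"
  assumes lip: "L-lipschitz_on UNIV \<phi>" and "\<phi> 0 = 0"
  shows "integrable (f t) \<phi>"
proof (rule integrable_weighted)
  show "\<phi> \<in> borel_measurable borel"
    by (intro borel_measurable_continuous_onI lipschitz_on_continuous_on[OF lip])
  show "\<bar>\<phi> v\<bar> \<le> L * (1 + v powr \<gamma>)" if "0 < v" for v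
  proof -
    have "\<bar>\<phi> v\<bar> \<le> L * v" using lipschitz_onD[OF lip, of v 0] assms(2) that by (simp add: dist_real_def)
    also have "\<dots> \<le> L * (1 + v powr \<gamma>)"
      using lipschitz_on_nonneg[OF lip] le_weight[OF that] by (rule mult_left_mono[rotated])
    finally show ?thesis .
  qed
qed

text \<open>Truncation to \<open>min \<phi> (n - v)\<^sub>+\<close> gives test functions with compact support and a common Lipschitz
  constant, so dominated convergence applies first in \<open>(v, w)\<close> and then in time.\<close>

lemma weak_eq_lipschitz_from_0:
  assumes \<phi>: "test_function L \<phi>" and t: "0 \<le> t" "t \<le> T"
  shows "(\<integral>v. \<phi> v \<partial>f t) - (\<integral>v. \<phi> v \<partial>f 0) = 1 / 2 * (LINT s:{0..t}|lborel. rate \<phi> s)"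
proof -
  note lip = test_functionD(1)[OF \<phi>] and nn = test_functionD(2)[OF \<phi>]
  obtain a where a: "0 < a" "\<And>x. x \<le> a \<Longrightarrow> \<phi> x = 0"
    using \<phi> by (auto simp: test_function_def)
  define \<psi> where "\<psi> n x = min (\<phi> x) (max 0 (real n - x))" for n :: nat and x
  have L0: "0 \<le> L" by (rule lipschitz_on_nonneg[OF lip])
  have psi_lip: "(L + 1)-lipschitz_on UNIV (\<psi> n)" for n
  proof (rule lipschitz_onI)
    fix x y :: real
    have "\<bar>\<phi> x - \<phi> y\<bar> \<le> L * \<bar>x - y\<bar>" using lipschitz_onD[OF lip, of x y] by (simp add: dist_real_def)
    moreover have "0 \<le> L * \<bar>x - y\<bar>" using L0 by simp
    ultimately have "\<bar>\<psi> n x - \<psi> n y\<bar> \<le> L * \<bar>x - y\<bar> + \<bar>x - y\<bar>"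
      unfolding \<psi>_def min_def max_def by (auto split: if_splits)
    then show "dist (\<psi> n x) (\<psi> n y) \<le> (L + 1) * dist x y"
      by (simp add: dist_real_def algebra_simps)
  qed (use L0 in simp)
  have psi0: "\<psi> n x = 0" if "x \<le> a" for n x using a(2)[OF that] by (simp add: \<psi>_def)
  have psi00: "\<psi> n 0 = 0" for n using psi0[of 0] a(1) by simp
  note phi00 = test_functionD(3)[OF \<phi>]
  have psi_eq: "\<forall>\<^sub>F n in sequentially. \<psi> n x = \<phi> x" for x
  proof -
    have "\<forall>\<^sub>F n in sequentially. \<phi> x + x \<le> real n"
      by (rule eventually_le_real)
    then show ?thesis by eventually_elim (auto simp: \<psi>_def nn)
  qed
  have lim: "(\<lambda>n. \<psi> n x) \<longlonglongrightarrow> \<phi> x" for x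
    by (rule tendsto_eventually[OF psi_eq])
  have psi_le: "\<bar>\<psi> n x\<bar> \<le> \<phi> x" for n x using nn[of x] by (simp add: \<psi>_def)
  have meas: "\<psi> n \<in> borel_measurable borel" "\<phi> \<in> borel_measurable borel" for n
    by (intro borel_measurable_continuous_onI lipschitz_on_continuous_on[OF psi_lip]
        lipschitz_on_continuous_on[OF lip])+
  have mass_lim: "(\<lambda>n. \<integral>v. \<psi> n v \<partial>f s) \<longlonglongrightarrow> (\<integral>v. \<phi> v \<partial>f s)" for s
  proof (rule integral_dominated_convergence)
    show "integrable (f s) \<phi>" by (rule lipschitz_integrable[OF lip phi00])
  qed (use psi_le lim in \<open>auto intro!: borel_measurable_f meas\<close>)
  have rate_lim: "(\<lambda>n. rate (\<psi> n) s) \<longlonglongrightarrow> rate \<phi> s" for s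
    unfolding rate_def
  proof (rule integral_dominated_convergence)
    show "integrable (f s \<Otimes>\<^sub>M f s) (\<lambda>z. 4 * (L + 1) * C * ((1 + fst z powr \<gamma>) * (1 + snd z powr \<gamma>)))"
      by (intro integrable_mult_right pair_integral_product(1) weight_integrable)
    show "AE z in f s \<Otimes>\<^sub>M f s. (\<lambda>n. collision (\<psi> n) z) \<longlonglongrightarrow> collision \<phi> z"
      unfolding collision_def by (intro AE_I2 tendsto_intros lim)
    show "AE z in f s \<Otimes>\<^sub>M f s. norm (collision (\<psi> n) z)
        \<le> 4 * (L + 1) * C * ((1 + fst z powr \<gamma>) * (1 + snd z powr \<gamma>))" for n
      using abs_collision_le[OF psi_lip[of n] psi00] by (intro AE_I2) auto
  qed (intro collision_measurable meas)+
  have "(\<lambda>n. LINT s:{0..t}|lborel. rate (\<psi> n) s) \<longlonglongrightarrow> (LINT s:{0..t}|lborel. rate \<phi> s)"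
    unfolding set_lebesgue_integral_def
  proof (rule integral_dominated_convergence)
    show "integrable lborel (\<lambda>r. indicator {0..t} r *\<^sub>R (4 * (L + 1) * C * M\<^sup>2))"
      by (intro integrable_scaleR_left integrable_real_indicator) (auto simp: emeasure_lborel_Icc_eq)
    show "AE r in lborel. (\<lambda>n. indicat_real {0..t} r *\<^sub>R rate (\<psi> n) r) \<longlonglongrightarrow> indicat_real {0..t} r *\<^sub>R rate \<phi> r"
      by (intro AE_I2 tendsto_intros rate_lim)
    show "AE r in lborel. norm (indicat_real {0..t} r *\<^sub>R rate (\<psi> n) r)
        \<le> indicator {0..t} r *\<^sub>R (4 * (L + 1) * C * M\<^sup>2)" for n
      using abs_rate_le[OF psi_lip[of n] psi00] by (intro AE_I2) (auto simp: indicator_def)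
  qed (use rate_measurable[OF psi_lip psi00] rate_measurable[OF lip phi00] in simp_all)
  then have "(\<lambda>n. 1 / 2 * (LINT s:{0..t}|lborel. rate (\<psi> n) s))
      \<longlonglongrightarrow> 1 / 2 * (LINT s:{0..t}|lborel. rate \<phi> s)"
    by (intro tendsto_intros)
  moreover have "1 / 2 * (LINT s:{0..t}|lborel. rate (\<psi> n) s) = (\<integral>v. \<psi> n v \<partial>f t) - (\<integral>v. \<psi> n v \<partial>f 0)" for n
    by (rule weak_eq_compact_support[OF psi_lip a(1) psi0 _ t, of "real n", symmetric])
      (use nn in \<open>auto simp: \<psi>_def\<close>)
  ultimately have "(\<lambda>n. (\<integral>v. \<psi> n v \<partial>f t) - (\<integral>v. \<psi> n v \<partial>f 0))
      \<longlonglongrightarrow> 1 / 2 * (LINT s:{0..t}|lborel. rate \<phi> s)"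
    by (simp only:)
  then show ?thesis
    by (rule LIMSEQ_unique[OF tendsto_diff[OF mass_lim[of t] mass_lim[of 0]]])
qed

lemma weak_eq_lipschitz:
  assumes \<phi>: "test_function L \<phi>" and st: "0 \<le> s" "s \<le> t" "t \<le> T"
  shows "(\<integral>v. \<phi> v \<partial>f t) - (\<integral>v. \<phi> v \<partial>f s) = 1 / 2 * (LINT r:{s..t}|lborel. rate \<phi> r)"
proof -
  note lip = test_functionD(1)[OF \<phi>] and phi00 = test_functionD(3)[OF \<phi>]
  have "(LINT r:{0..s} \<union> {s..t}|lborel. rate \<phi> r)
      = (LINT r:{0..s}|lborel. rate \<phi> r) + (LINT r:{s..t}|lborel. rate \<phi> r)"
    using AE_lborel_singleton[of s]
    by (intro set_integral_Un_AE rate_set_integrable[OF lip phi00]) (auto elim: eventually_mono)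
  moreover have "{0..s} \<union> {s..t} = {0..t}" using st by auto
  ultimately have "(LINT r:{0..t}|lborel. rate \<phi> r)
      = (LINT r:{0..s}|lborel. rate \<phi> r) + (LINT r:{s..t}|lborel. rate \<phi> r)" by simp
  then show ?thesis
    using weak_eq_lipschitz_from_0[OF \<phi>, of t] weak_eq_lipschitz_from_0[OF \<phi>, of s] st
    by (simp add: algebra_simps)
qed

lemma integral_rate_mono:
  assumes lip: "L-lipschitz_on UNIV \<phi>" "\<phi> 0 = 0" and g: "continuous_on {s..t} g"
    and le: "\<And>r. r \<in> {s..t} \<Longrightarrow> g r \<le> rate \<phi> r"
  shows "integral {s..t} g \<le> (LINT r:{s..t}|lborel. rate \<phi> r)"
proof -
  have "set_integrable lborel {s..t} g" by (rule borel_integrable_atLeastAtMost') fact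
  then have "integral {s..t} g = (LINT r:{s..t}|lborel. g r)"
    by (rule set_borel_integral_eq_integral(2)[symmetric])
  also have "\<dots> \<le> (LINT r:{s..t}|lborel. rate \<phi> r)"
    by (rule set_integral_mono) (use rate_set_integrable[OF lip] le \<open>set_integrable lborel {s..t} g\<close> in auto)
  finally show ?thesis .
qed

lemma moment_lipschitz_in_time:
  assumes \<phi>: "test_function L \<phi>" and st: "0 \<le> s" "s \<le> t" "t \<le> T"
  shows "\<bar>(\<integral>v. \<phi> v \<partial>f t) - (\<integral>v. \<phi> v \<partial>f s)\<bar> \<le> 2 * L * C * M\<^sup>2 * (t - s)"
proof -
  note lip = test_functionD(1)[OF \<phi>] and phi00 = test_functionD(3)[OF \<phi>]
  have "\<bar>LINT r:{s..t}|lborel. rate \<phi> r\<bar> \<le> (LINT r:{s..t}|lborel. \<bar>rate \<phi> r\<bar>)"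
    using set_integral_norm_bound[OF rate_set_integrable[OF lip phi00]] by simp
  also have "\<dots> \<le> (LINT r:{s..t}|lborel. 4 * L * C * M\<^sup>2)"
  proof (rule set_integral_mono)
    show "set_integrable lborel {s..t} (\<lambda>r. \<bar>rate \<phi> r\<bar>)"
      by (rule set_integrable_abs[OF rate_set_integrable[OF lip phi00]])
    show "set_integrable lborel {s..t} (\<lambda>r. 4 * L * C * M\<^sup>2)"
      by (rule borel_integrable_atLeastAtMost') simp
  qed (use abs_rate_le[OF lip phi00] in auto)
  also have "\<dots> = 4 * L * C * M\<^sup>2 * (t - s)"
    using st by (simp add: set_lebesgue_integral_def)
  finally show ?thesis
    using weak_eq_lipschitz[OF \<phi> st] by simp
qed

lemma moment_continuous_in_time:
  assumes \<phi>: "test_function L \<phi>" and I: "I \<subseteq> {0..T}"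
  shows "continuous_on I (\<lambda>t. \<integral>v. \<phi> v \<partial>f t)"
proof -
  have "(2 * L * C * M\<^sup>2)-lipschitz_on {0..T} (\<lambda>t. \<integral>v. \<phi> v \<partial>f t)"
    by (rule lipschitz_on_leI)
      (use moment_lipschitz_in_time[OF \<phi>] test_functionD(4)[OF \<phi>] C_nonneg
        in \<open>auto simp: dist_real_def abs_minus_commute\<close>)
  then show ?thesis
    using I by (blast intro: continuous_on_subset lipschitz_on_continuous_on)
qed

end

section \<open>Propagation of the support\<close>

text \<open>Support points of a measure, phrased through integrals of continuous functions because these are
  what the weak equation controls.\<close>

definition in_support :: "real measure \<Rightarrow> real \<Rightarrow> bool" where
  "in_support \<mu> x \<longleftrightarrow> 0 < x \<and> (\<forall>r. 0 < r \<and> r < x \<longrightarrow> 0 < (\<integral>v. tent x r v \<partial>\<mu>))"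

context coagulation_flow begin

lemma test_function_integrable:
  "test_function L \<phi> \<Longrightarrow> integrable (f t) \<phi>"
  by (rule lipschitz_integrable[OF test_functionD(1,3)])

text \<open>For \<open>\<phi>\<close> supported in \<open>[0, b]\<close> the loss term is at most a constant times \<open>\<integral>\<phi>\<close>: where \<open>\<phi> v \<noteq> 0\<close>, the
  kernel is at most \<open>C (b\<^sup>\<gamma> + w\<^sup>\<gamma>)\<close>, which is integrable in \<open>w\<close>. The gain term is bounded
  below by a product, so that its double integral factorises.\<close>

lemma rate_ge_gain_minus_loss:
  assumes \<phi>: "test_function L \<phi>" and b: "0 \<le> b" "\<And>v. b \<le> v \<Longrightarrow> \<phi> v = 0"
    and c: "0 \<le> c" "integrable (f t) \<psi>" "integrable (f t) \<eta>"
      "\<And>v w. 0 < v \<Longrightarrow> 0 < w \<Longrightarrow> c * (\<psi> v * \<eta> w) \<le> K v w * \<phi> (v + w)"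
  shows "c * ((\<integral>v. \<psi> v \<partial>f t) * (\<integral>v. \<eta> v \<partial>f t)) - 2 * (C * (1 + b powr \<gamma>) * M) * (\<integral>v. \<phi> v \<partial>f t) \<le> rate \<phi> t"
proof -
  define W where "W v = 1 + v powr \<gamma>" for v
  define B where "B = C * (1 + b powr \<gamma>)"
  have B0: "0 \<le> B" using C_nonneg by (simp add: B_def)
  have intW: "integrable (f t) W" and int\<phi>: "integrable (f t) \<phi>"
    unfolding W_def by (rule weight_integrable, rule test_function_integrable[OF \<phi>])
  have loss: "C * (v powr \<gamma> + w powr \<gamma>) * \<phi> v \<le> B * (\<phi> v * W w)" if "0 < v" "0 < w" for v w
  proof (cases "b \<le> v")
    case False
    then have "v powr \<gamma> \<le> b powr \<gamma>" using that gamma by (intro powr_mono2) auto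
    then have "v powr \<gamma> + w powr \<gamma> \<le> (1 + b powr \<gamma>) * W w"
      using mult_nonneg_nonneg[OF powr_ge_zero[of b \<gamma>] powr_ge_zero[of w \<gamma>]]
      unfolding W_def distrib_left distrib_right mult_1_left mult_1_right by linarith
    then have "(C * \<phi> v) * (v powr \<gamma> + w powr \<gamma>) \<le> (C * \<phi> v) * ((1 + b powr \<gamma>) * W w)"
      using C_nonneg test_functionD(2)[OF \<phi>] by (intro mult_left_mono) auto
    then show ?thesis by (simp add: B_def algebra_simps)
  qed (simp add: b)
  define \<Psi> where "\<Psi> z = c * (\<psi> (fst z) * \<eta> (snd z)) - (B * (\<phi> (fst z) * W (snd z)) + B * (W (fst z) * \<phi> (snd z)))"
    for z
  have "\<Psi> z \<le> collision \<phi> z" if zs: "z \<in> space (f t \<Otimes>\<^sub>M f t)" for z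
  proof -
    obtain v w where z: "z = (v, w)" "0 < v" "0 < w" using zs by (cases z) auto
    have "K v w * \<phi> v \<le> B * (\<phi> v * W w)"
      using loss[OF z(2,3)] K_le[OF z(2,3)] test_functionD(2)[OF \<phi>]
      by (meson mult_right_mono order_trans)
    moreover have "K v w * \<phi> w \<le> B * (W v * \<phi> w)"
    proof -
      have "K v w * \<phi> w \<le> C * (v powr \<gamma> + w powr \<gamma>) * \<phi> w"
        using K_le[OF z(2,3)] test_functionD(2)[OF \<phi>] by (intro mult_right_mono)
      also have "\<dots> \<le> B * (\<phi> w * W v)" using loss[OF z(3,2)] by (simp add: add.commute)
      finally show ?thesis by (simp add: mult.commute)
    qed
    ultimately show ?thesis
      using c(4)[OF z(2,3)] by (simp add: z(1) \<Psi>_def collision_def right_diff_distrib)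
  qed
  moreover have int\<Psi>: "integrable (f t \<Otimes>\<^sub>M f t) \<Psi>"
    unfolding \<Psi>_def
    by (intro Bochner_Integration.integrable_diff Bochner_Integration.integrable_add
        integrable_mult_right pair_integral_product(1) c intW int\<phi>)
  moreover have "integrable (f t \<Otimes>\<^sub>M f t) (collision \<phi>)"
    by (rule collision_integrable) (rule test_functionD[OF \<phi>])+
  ultimately have le: "(\<integral>z. \<Psi> z \<partial>(f t \<Otimes>\<^sub>M f t)) \<le> rate \<phi> t"
    unfolding rate_def by (intro integral_mono)
  have "(\<integral>z. \<Psi> z \<partial>(f t \<Otimes>\<^sub>M f t)) = c * ((\<integral>v. \<psi> v \<partial>f t) * (\<integral>v. \<eta> v \<partial>f t))
      - (B * ((\<integral>v. \<phi> v \<partial>f t) * (\<integral>v. W v \<partial>f t)) + B * ((\<integral>v. W v \<partial>f t) * (\<integral>v. \<phi> v \<partial>f t)))"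
    unfolding \<Psi>_def using c intW int\<phi>
    by (simp add: pair_integral_product)
  moreover have "B * ((\<integral>v. W v \<partial>f t) * (\<integral>v. \<phi> v \<partial>f t)) \<le> B * (M * (\<integral>v. \<phi> v \<partial>f t))"
    using weight_integral B0 test_functionD(2)[OF \<phi>] unfolding W_def
    by (intro mult_left_mono mult_right_mono Bochner_Integration.integral_nonneg) auto
  ultimately show ?thesis using le by (simp add: B_def algebra_simps)
qed

text \<open>Loss is at most linear in the amount present, so an amount cannot reach zero in finite time.\<close>

lemma zero_backward:
  assumes \<phi>: "test_function L \<phi>" and b: "0 \<le> b" "\<And>v. b \<le> v \<Longrightarrow> \<phi> v = 0"
    and st: "0 \<le> s" "s \<le> t" "t \<le> T" and zero: "(\<integral>v. \<phi> v \<partial>f t) = 0"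
  shows "(\<integral>v. \<phi> v \<partial>f s) = 0"
proof (rule backward_gronwall_zero[where y = "\<lambda>r. \<integral>v. \<phi> v \<partial>f r" and s = s and t = t and c = "C * (1 + b powr \<gamma>) * M"])
  let ?c = "C * (1 + b powr \<gamma>) * M"
  show "s \<le> t" by fact
  show "0 \<le> ?c" using C_nonneg M_pos by simp
  show cont: "continuous_on {s..t} (\<lambda>r. \<integral>v. \<phi> v \<partial>f r)"
    by (rule moment_continuous_in_time[OF \<phi>]) (use st in auto)
  show "0 \<le> (\<integral>v. \<phi> v \<partial>f r)" for r
    using test_functionD(2)[OF \<phi>] by (intro Bochner_Integration.integral_nonneg)
  fix r assume r: "r \<in> {s..t}"
  have "integral {r..t} (\<lambda>u. - 2 * ?c * (\<integral>v. \<phi> v \<partial>f u)) \<le> (LINT u:{r..t}|lborel. rate \<phi> u)"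
  proof (rule integral_rate_mono)
    show "continuous_on {r..t} (\<lambda>u. - 2 * ?c * (\<integral>v. \<phi> v \<partial>f u))"
      using r by (intro continuous_intros continuous_on_subset[OF cont]) auto
    show "- 2 * ?c * (\<integral>v. \<phi> v \<partial>f u) \<le> rate \<phi> u" for u
      using rate_ge_gain_minus_loss[OF \<phi> b, of 0 u "\<lambda>_. 0" "\<lambda>_. 0"]
        K_nonneg test_functionD(2)[OF \<phi>] by simp
  qed (rule test_functionD[OF \<phi>])+
  then show "(\<integral>v. \<phi> v \<partial>f r) \<le> ?c * integral {r..t} (\<lambda>u. \<integral>v. \<phi> v \<partial>f u)"
    using weak_eq_lipschitz[OF \<phi>, of r t] r st zero by simp
qed

lemma tent_moment_nonneg: "0 \<le> (\<integral>v. tent x r v \<partial>f t)"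
  by (intro Bochner_Integration.integral_nonneg) simp

lemma support_persists:
  assumes "in_support (f s) x" "0 \<le> s" "s \<le> t" "t \<le> T"
  shows "in_support (f t) x"
  unfolding in_support_def
proof (intro conjI allI impI)
  show "0 < x" using assms(1) by (simp add: in_support_def)
  fix r assume r: "0 < r \<and> r < x"
  have "(\<integral>v. tent x r v \<partial>f t) \<noteq> 0"
    using zero_backward[OF tent_test_function, of r x "x + r" s t] assms r
    by (auto simp: in_support_def tent_eq_0)
  then show "0 < (\<integral>v. tent x r v \<partial>f t)" using tent_moment_nonneg[of x r t] by (simp add: less_le)
qed

text \<open>If a neighbourhood of \<open>x + y\<close> were empty at time \<open>t\<close>, it would have been empty before, so that its
  loss term vanishes; but encounters of clusters near \<open>x\<close> with clusters near \<open>y\<close> feed it at a positive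
  rate throughout \<open>[t / 2, t]\<close>.\<close>

lemma support_add:
  assumes x: "\<And>s. 0 < s \<Longrightarrow> s \<le> T \<Longrightarrow> in_support (f s) x"
    and y: "\<And>s. 0 < s \<Longrightarrow> s \<le> T \<Longrightarrow> in_support (f s) y"
    and "x \<noteq> y" and t: "0 < t" "t \<le> T"
  shows "in_support (f t) (x + y)"
  unfolding in_support_def
proof (intro conjI allI impI)
  have pos: "0 < x" "0 < y" using x[OF t] y[OF t] by (auto simp: in_support_def)
  then show "0 < x + y" by simp
  fix r assume r: "0 < r \<and> r < x + y"
  let ?\<phi> = "tent (x + y) r"
  have \<phi>: "test_function 1 ?\<phi>" using r by (intro tent_test_function) simp
  obtain \<rho> c where \<rho>: "0 < \<rho>" "0 < c" "\<rho> < x" "\<rho> < y"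
    and c: "\<And>v w. v \<in> {x - \<rho>..x + \<rho>} \<Longrightarrow> w \<in> {y - \<rho>..y + \<rho>} \<Longrightarrow> c \<le> K v w"
    using K_locally_positive[OF pos \<open>x \<noteq> y\<close>] by blast
  define d where "d = min \<rho> (r / 4)"
  have d: "0 < d" "d \<le> \<rho>" "4 * d \<le> r" "d < x" "d < y" using \<rho> r by (auto simp: d_def)
  define c' where "c' = c * (r / 2) / d\<^sup>2"
  have c': "0 < c'" using \<rho> r d by (simp add: c'_def)
  have gain: "c' * (tent x d v * tent y d w) \<le> K v w * ?\<phi> (v + w)" if "0 < v" "0 < w" for v w
  proof (cases "\<bar>v - x\<bar> < d \<and> \<bar>w - y\<bar> < d")
    case True
    have "c' * (tent x d v * tent y d w) \<le> c' * (d * d)"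
      using c' d by (intro mult_left_mono mult_mono) auto
    also have "\<dots> = c * (r / 2)" using d by (simp add: c'_def power2_eq_square)
    also have "\<dots> \<le> K v w * ?\<phi> (v + w)"
    proof (rule mult_mono)
      show "c \<le> K v w" using True d by (intro c) auto
      show "r / 2 \<le> ?\<phi> (v + w)" using True d unfolding tent_def by linarith
    qed (use r K_nonneg[OF that] in auto)
    finally show ?thesis .
  next
    case False
    have "c' * (tent x d v * tent y d w) = 0" using False by (auto simp: tent_def)
    moreover have "0 \<le> K v w * ?\<phi> (v + w)" using K_nonneg[OF that] by simp
    ultimately show ?thesis by linarith
  qed
  \<comment> \<open>The choice \<open>d \<le> r / 4\<close> keeps sums of nearby sizes within \<open>r / 2\<close> of \<open>x + y\<close>.\<close>
  define P where "P s = (\<integral>v. tent x d v \<partial>f s) * (\<integral>v. tent y d v \<partial>f s)" for s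
  have "(\<integral>v. ?\<phi> v \<partial>f t) \<noteq> 0"
  proof
    assume zero: "(\<integral>v. ?\<phi> v \<partial>f t) = 0"
    have zero': "(\<integral>v. ?\<phi> v \<partial>f s) = 0" if "0 \<le> s" "s \<le> t" for s
      by (rule zero_backward[OF \<phi>, of "x + y + r" s t]) (use that zero r t pos in \<open>auto simp: tent_eq_0\<close>)
    have rate_ge: "c' * P s \<le> rate ?\<phi> s" if "0 \<le> s" "s \<le> t" for s
      using rate_ge_gain_minus_loss[OF \<phi>, of "x + y + r" c' s "tent x d" "tent y d"]
        zero'[OF that] gain c' d r pos
      by (simp add: tent_eq_0 P_def test_function_integrable[OF tent_test_function])
    have P_cont: "continuous_on {t / 2..t} P"
      unfolding P_def using t d
      by (intro continuous_intros moment_continuous_in_time[OF tent_test_function]) auto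
    have P_pos: "0 < P s" if "0 < s" "s \<le> t" for s
      using x[of s] y[of s] that t d by (simp add: in_support_def P_def)
    obtain s0 where s0: "s0 \<in> {t / 2..t}" "\<And>s. s \<in> {t / 2..t} \<Longrightarrow> P s0 \<le> P s"
      using continuous_attains_inf[OF compact_Icc _ P_cont] t by auto
    have "integral {t / 2..t} (\<lambda>s. c' * P s0) \<le> (LINT s:{t / 2..t}|lborel. rate ?\<phi> s)"
    proof (rule integral_rate_mono)
      show "c' * P s0 \<le> rate ?\<phi> s" if "s \<in> {t / 2..t}" for s
        using s0(2)[OF that] c' rate_ge[of s] that t
        by (auto intro: order_trans[OF mult_left_mono])
    qed (rule test_functionD[OF \<phi>] continuous_on_const)+
    also have "\<dots> = 0"
      using weak_eq_lipschitz[OF \<phi>, of "t / 2" t] zero' t by simp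
    finally have "c' * P s0 * (t / 2) \<le> 0" using t by (simp add: mult_ac)
    moreover have "0 < c' * P s0 * (t / 2)"
      using c' P_pos[of s0] s0(1) t by (intro mult_pos_pos) auto
    ultimately show False by simp
  qed
  then show "0 < (\<integral>v. ?\<phi> v \<partial>f t)" using tent_moment_nonneg[of "x + y" r t] by (simp add: less_le)
qed

lemma support_unbounded:
  assumes "in_support (f 0) x" "in_support (f 0) y" "x < y" and t: "0 < t" "t \<le> T"
  shows "in_support (f t) (y + real n * x)"
  using t
proof (induction n arbitrary: t)
  case 0
  then show ?case using support_persists[OF assms(2), of t] by simp
next
  case (Suc n)
  have "0 < x" using assms(1) by (simp add: in_support_def)
  then have ne: "x \<noteq> y + real n * x"
    using assms(3) by (smt (verit) mult_nonneg_nonneg of_nat_0_le_iff)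
  have "in_support (f t) (x + (y + real n * x))"
    by (rule support_add) (use Suc ne support_persists[OF assms(1)] in auto)
  then show ?case by (simp add: algebra_simps)
qed

end

section \<open>Escape of large clusters to infinity\<close>

context coagulation_flow begin

text \<open>All encounters contribute a nonnegative amount by superadditivity. Those between a cluster beyond
  \<open>A\<close> and a cluster of size \<open>w\<close> in the window around \<open>x\<close> raise the excess by at least \<open>w * ramp A v\<close>,
  and \<open>tent x r w \<le> w\<close>.\<close>

lemma rate_huber_ge:
  assumes "0 < r" "r < x" "H \<le> A" "3 * (x + r) \<le> A"
  shows "\<kappa> * A powr \<gamma> * ((\<integral>v. ramp A v \<partial>f t) * (\<integral>v. tent x r v \<partial>f t)) \<le> rate (huber A) t"
proof -
  have A: "0 < A" using assms H_pos by linarith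
  have "\<kappa> * A powr \<gamma> * (ramp A v * tent x r w) \<le> collision (huber A) (v, w)"
    if "0 < v" "0 < w" for v w
  proof (cases "A < v \<and> w < x + r")
    case True
    have "\<kappa> * A powr \<gamma> \<le> \<kappa> * v powr \<gamma>"
      using True A gamma kappa_pos by (intro mult_left_mono powr_mono2) auto
    also have "\<dots> \<le> K v w"
      using True assms that by (intro K_ge) auto
    finally have K: "\<kappa> * A powr \<gamma> \<le> K v w" .
    have "ramp A v * tent x r w \<le> ramp A v * w"
      using assms that by (intro mult_left_mono tent_le_self) auto
    also have "\<dots> \<le> huber A (v + w) - huber A v - huber A w"
      using huber_tangent[of A v "v + w"] huber_eq_0[of w A] True assms that by simp
    finally have "(\<kappa> * A powr \<gamma>) * (ramp A v * tent x r w)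
        \<le> K v w * (huber A (v + w) - huber A v - huber A w)"
      using K K_nonneg[OF that] by (intro mult_mono) auto
    then show ?thesis by (simp add: collision_def)
  next
    case False
    have "0 \<le> huber A (v + w) - huber A v - huber A w"
      using huber_superadditive[of A v w] A that by simp
    then have "0 \<le> collision (huber A) (v, w)"
      using K_nonneg[OF that] by (simp add: collision_def)
    moreover have "ramp A v * tent x r w = 0"
      using False by (auto simp: ramp_def tent_eq_0)
    ultimately show ?thesis by (simp only: mult_zero_right)
  qed
  moreover have int: "integrable (f t) (ramp A)" "integrable (f t) (tent x r)"
    using A assms by (auto intro!: test_function_integrable ramp_test_function tent_test_function)
  moreover have "integrable (f t \<Otimes>\<^sub>M f t) (collision (huber A))"
    by (rule collision_integrable[OF test_functionD(1,3)]) (rule huber_test_function[OF A])+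
  ultimately have "(\<integral>z. \<kappa> * A powr \<gamma> * (ramp A (fst z) * tent x r (snd z)) \<partial>(f t \<Otimes>\<^sub>M f t))
      \<le> rate (huber A) t"
    unfolding rate_def
    by (intro integral_mono integrable_mult_right pair_integral_product(1)) auto
  then show ?thesis
    by (simp add: pair_integral_product(2)[OF int])
qed

text \<open>Growth of the excess at fixed threshold and its decrease under a shift of the threshold are both
  governed by the moment of \<open>ramp\<close>; at the chosen speed they cancel to first order. Since that
  moment is Lipschitz in the time and in the threshold, the error over a step of length \<open>d\<close> is of order
  \<open>d\<^sup>2\<close>, and these errors disappear under subdivision. A constant speed suffices, because the
  threshold is only followed while it doubles.\<close>

lemma advancing_front:
  assumes r: "0 < r" "r < x" and A: "H \<le> A" "3 * (x + r) \<le> A"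
    and m: "0 \<le> m" "\<And>s. 0 \<le> s \<Longrightarrow> s \<le> T \<Longrightarrow> m \<le> (\<integral>v. tent x r v \<partial>f s)"
    and st: "0 \<le> s" "s \<le> t" "t \<le> T"
  shows "(\<integral>v. huber A v \<partial>f s) \<le> (\<integral>v. huber (A + \<kappa> * m / 2 * A powr \<gamma> * (t - s)) v \<partial>f t)"
proof -
  define \<sigma> where "\<sigma> = \<kappa> * m / 2 * A powr \<gamma>"
  have \<sigma>: "0 \<le> \<sigma>" using m kappa_pos by (simp add: \<sigma>_def)
  have A0: "0 < A" using A H_pos by linarith
  define b where "b u = A + \<sigma> * (u - s)" for u
  define D where "D = \<sigma> * M + 2 * C * M\<^sup>2"
  have "(\<integral>v. huber (b s) v \<partial>f s) \<le> (\<integral>v. huber (b t) v \<partial>f t)"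
  proof (rule nondecreasing_of_quadratic_defect[where G = "\<lambda>u. \<integral>v. huber (b u) v \<partial>f u"])
    show "s \<le> t" by fact
    fix u u' assume u: "s \<le> u" "u \<le> u'" "u' \<le> t"
    define d where "d = u' - u"
    have d: "0 \<le> d" using u by (simp add: d_def)
    have ge: "A \<le> b u" using \<sigma> u by (simp add: b_def)
    have bu': "b u' = b u + \<sigma> * d" by (simp add: b_def d_def algebra_simps)
    then have ge': "b u \<le> b u'" "A \<le> b u'" using ge mult_nonneg_nonneg[OF \<sigma> d] by linarith+
    have pos: "0 < b u" "0 < b u'" using ge ge' A0 by linarith+
    define P where "P = (\<integral>v. ramp (b u) v \<partial>f u)"
    have int: "integrable (f q) (ramp (b u))" "integrable (f q) (ramp (b u'))"
      "integrable (f q) (huber (b u))" "integrable (f q) (huber (b u'))" for q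
      using pos by (auto intro!: test_function_integrable ramp_test_function huber_test_function)
    \<comment> \<open>\<open>D\<close> collects the Lipschitz constants of the ramp moment in the threshold and in the time.\<close>
    have ramp_ge: "P - D * d \<le> (\<integral>v. ramp (b u') v \<partial>f q)" if q: "q \<in> {u..u'}" for q
    proof -
      have "\<bar>\<integral>v. ramp (b u) v - ramp (b u') v \<partial>f q\<bar> \<le> \<sigma> * d * M"
      proof (rule abs_integral_weighted)
        show "(\<lambda>v. ramp (b u) v - ramp (b u') v) \<in> borel_measurable borel"
          using pos by (intro borel_measurable_diff test_functionD(5)[OF ramp_test_function])
        fix v :: real assume "0 < v"
        have "\<bar>ramp (b u) v - ramp (b u') v\<bar> \<le> \<sigma> * d"
          using ge' bu' by (auto simp: ramp_def)
        also have "\<dots> \<le> \<sigma> * d * (1 + v powr \<gamma>)"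
          using \<sigma> d by (simp add: distrib_left)
        finally show "\<bar>ramp (b u) v - ramp (b u') v\<bar> \<le> \<sigma> * d * (1 + v powr \<gamma>)" .
      qed
      then have 1: "(\<integral>v. ramp (b u) v \<partial>f q) - \<sigma> * d * M \<le> (\<integral>v. ramp (b u') v \<partial>f q)"
        using int by (simp add: abs_le_iff)
      have "\<bar>(\<integral>v. ramp (b u) v \<partial>f q) - P\<bar> \<le> 2 * 1 * C * M\<^sup>2 * (q - u)"
        unfolding P_def using q u st pos
        by (intro moment_lipschitz_in_time ramp_test_function) auto
      also have "\<dots> \<le> 2 * 1 * C * M\<^sup>2 * d"
        using q C_nonneg by (intro mult_left_mono) (auto simp: d_def)
      finally show ?thesis using 1 by (simp add: D_def algebra_simps abs_le_iff)
    qed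
    have "\<sigma> * d * (P - D * d) \<le> (\<integral>v. huber (b u') v \<partial>f u') - (\<integral>v. huber (b u') v \<partial>f u)"
    proof -
      have "2 * \<sigma> * (P - D * d) \<le> rate (huber (b u')) q" if q: "q \<in> {u..u'}" for q
      proof -
        let ?R = "\<integral>v. ramp (b u') v \<partial>f q" and ?S = "\<integral>v. tent x r v \<partial>f q"
        have R0: "0 \<le> ?R" by (intro Bochner_Integration.integral_nonneg) simp
        have "2 * \<sigma> * (P - D * d) \<le> 2 * \<sigma> * ?R"
          using \<sigma> ramp_ge[OF q] by (intro mult_left_mono) auto
        also have "\<dots> = \<kappa> * A powr \<gamma> * (?R * m)" by (simp add: \<sigma>_def)
        also have "\<dots> \<le> \<kappa> * b u' powr \<gamma> * (?R * ?S)"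
        proof (rule mult_mono)
          show "\<kappa> * A powr \<gamma> \<le> \<kappa> * b u' powr \<gamma>"
            using ge' A0 gamma kappa_pos by (intro mult_left_mono powr_mono2) auto
          show "?R * m \<le> ?R * ?S" using R0 m(2)[of q] q u st by (intro mult_left_mono) auto
        qed (use R0 m(1) kappa_pos in auto)
        also have "\<dots> \<le> rate (huber (b u')) q"
          using ge' A by (intro rate_huber_ge r) auto
        finally show ?thesis .
      qed
      then have "integral {u..u'} (\<lambda>_. 2 * \<sigma> * (P - D * d)) \<le> (LINT q:{u..u'}|lborel. rate (huber (b u')) q)"
        using pos by (intro integral_rate_mono[OF huber_lipschitz] huber_eq_0) auto
      then show ?thesis
        using weak_eq_lipschitz[OF huber_test_function[OF pos(2)], of u u'] u st
        by (simp add: d_def algebra_simps)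
    qed
    moreover have "(\<integral>v. huber (b u) v \<partial>f u) - \<sigma> * d * P \<le> (\<integral>v. huber (b u') v \<partial>f u)"
    proof -
      have "(\<integral>v. huber (b u) v - \<sigma> * d * ramp (b u) v \<partial>f u) \<le> (\<integral>v. huber (b u') v \<partial>f u)"
        using huber_shift[OF ge'(1)] bu' int
        by (intro integral_mono Bochner_Integration.integrable_diff integrable_mult_right) auto
      then show ?thesis using int by (simp add: P_def)
    qed
    ultimately show "(\<integral>v. huber (b u) v \<partial>f u) - \<sigma> * D * (u' - u)\<^sup>2 \<le> (\<integral>v. huber (b u') v \<partial>f u')"
      unfolding d_def[symmetric] by (simp add: algebra_simps power2_eq_square)
  qed
  then show ?thesis by (simp add: b_def \<sigma>_def)
qed

text \<open>By persistence of the support, the moment is positive at all times; being continuous in time, it has a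
  positive minimum.\<close>

lemma tent_moment_bounded_below:
  assumes "in_support (f 0) x" "0 < r" "r < x"
  obtains m where "0 < m" "\<And>s. 0 \<le> s \<Longrightarrow> s \<le> T \<Longrightarrow> m \<le> (\<integral>v. tent x r v \<partial>f s)"
proof -
  have "continuous_on {0..T} (\<lambda>s. \<integral>v. tent x r v \<partial>f s)"
    using assms by (intro moment_continuous_in_time[OF tent_test_function]) auto
  then obtain s where s: "s \<in> {0..T}"
    and le: "\<And>q. q \<in> {0..T} \<Longrightarrow> (\<integral>v. tent x r v \<partial>f s) \<le> (\<integral>v. tent x r v \<partial>f q)"
    using continuous_attains_inf[OF compact_Icc, of 0 T] T_pos by force
  have "0 < (\<integral>v. tent x r v \<partial>f s)"
    using support_persists[OF assms(1), of s] s assms by (auto simp: in_support_def)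
  then show ?thesis using that le by auto
qed

lemma huber_moment_le:
  assumes "0 < A" shows "(\<integral>v. huber A v \<partial>f t) \<le> A powr (1 - \<gamma>) * M"
proof -
  have "\<bar>\<integral>v. huber A v \<partial>f t\<bar> \<le> A powr (1 - \<gamma>) * M"
  proof (rule abs_integral_weighted)
    show "huber A \<in> borel_measurable borel"
      by (rule test_functionD(5)[OF huber_test_function[OF assms]])
    fix v :: real assume "0 < v"
    then have "huber A v \<le> A powr (1 - \<gamma>) * v powr \<gamma>" by (intro huber_le_powr assms gamma)
    also have "\<dots> \<le> A powr (1 - \<gamma>) * (1 + v powr \<gamma>)" by (intro mult_left_mono) auto
    finally show "\<bar>huber A v\<bar> \<le> A powr (1 - \<gamma>) * (1 + v powr \<gamma>)" by simp
  qed
  then show ?thesis by simp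
qed

text \<open>From threshold \<open>B\<close>, doubling takes the time \<open>B\<^bsup>1 - \<gamma>\<^esup> / c\<close>. Over all further doublings these times
  form a geometric series of ratio \<open>q = 2\<^bsup>1 - \<gamma>\<^esup>\<close> with sum \<open>\<tau> B\<close>, so a threshold that is at \<open>B\<close> at time
  \<open>T - \<tau> B\<close> is at \<open>2 B\<close> at time \<open>T - \<tau> (2 B)\<close> and reaches infinity at time \<open>T\<close>.\<close>

theorem at_most_one_support_point:
  assumes x: "in_support (f 0) x" and y: "in_support (f 0) y" and "x < y"
  shows False
proof -
  have x0: "0 < x" using x by (simp add: in_support_def)
  define r where "r = x / 2"
  have r: "0 < r" "r < x" using x0 by (auto simp: r_def)
  obtain m where m: "0 < m" "\<And>s. 0 \<le> s \<Longrightarrow> s \<le> T \<Longrightarrow> m \<le> (\<integral>v. tent x r v \<partial>f s)"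
    using tent_moment_bounded_below[OF x r] by blast
  define c where "c = \<kappa> * m / 2"
  define q where "q = (2 :: real) powr (1 - \<gamma>)"
  have c: "0 < c" using m kappa_pos by (simp add: c_def)
  have q: "0 < q" "q < 1" using gamma by (auto simp: q_def powr_less_one)
  define \<tau> where "\<tau> A = A powr (1 - \<gamma>) / (c * (1 - q))" for A
  have \<tau>0: "0 < \<tau> A" if "0 < A" for A using that c q by (simp add: \<tau>_def)
  have \<tau>2: "\<tau> A - \<tau> (2 * A) = A powr (1 - \<gamma>) / c" if "0 < A" for A
  proof -
    have "\<tau> (2 * A) = q * \<tau> A" using that by (simp add: \<tau>_def q_def powr_mult)
    then have "\<tau> A - \<tau> (2 * A) = (1 - q) * \<tau> A" by (simp add: algebra_simps)
    then show ?thesis using c q by (simp add: \<tau>_def)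
  qed
  have "(\<tau> \<longlongrightarrow> 0) at_top"
    unfolding \<tau>_def using gamma
    by (intro tendsto_divide_zero tendsto_neg_powr filterlim_ident) simp
  then have "\<forall>\<^sub>F A in at_top. \<tau> A < T"
    using T_pos by (rule order_tendstoD(2))
  then have "\<forall>\<^sub>F A in at_top. \<tau> A < T \<and> H \<le> A \<and> 3 * (x + r) \<le> A"
    by (intro eventually_conj eventually_ge_at_top)
  then obtain A where A: "\<tau> A < T" "H \<le> A" "3 * (x + r) \<le> A"
    using eventually_happens'[OF trivial_limit_at_top_linorder] by blast
  have A0: "0 < A" using A H_pos by linarith
  have step: "(\<integral>v. huber B v \<partial>f (T - \<tau> B)) \<le> (\<integral>v. huber (2 * B) v \<partial>f (T - \<tau> (2 * B)))"
    if B: "A \<le> B" "\<tau> B \<le> T" for B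
  proof -
    have B0: "0 < B" using A0 B by simp
    have d: "0 \<le> \<tau> B - \<tau> (2 * B)" using \<tau>2[OF B0] c by simp
    have "(\<integral>v. huber B v \<partial>f (T - \<tau> B))
        \<le> (\<integral>v. huber (B + \<kappa> * m / 2 * B powr \<gamma> * (T - \<tau> (2 * B) - (T - \<tau> B))) v \<partial>f (T - \<tau> (2 * B)))"
      using B A d m \<tau>0[of "2 * B"] B0 by (intro advancing_front[OF r]) auto
    also have "B + \<kappa> * m / 2 * B powr \<gamma> * (T - \<tau> (2 * B) - (T - \<tau> B)) = B + c * B powr \<gamma> * (\<tau> B - \<tau> (2 * B))"
      by (simp add: c_def)
    \<comment> \<open>The time \<open>\<tau> B - \<tau> (2 * B)\<close> is exactly what the front needs to advance by \<open>B\<close>.\<close>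
    also have "\<dots> = B + B powr \<gamma> * B powr (1 - \<gamma>)"
      using c by (simp add: \<tau>2[OF B0])
    also have "\<dots> = 2 * B" using B0 by (simp flip: powr_add)
    finally show ?thesis .
  qed
  have grow: "(\<integral>v. huber A v \<partial>f (T - \<tau> A)) \<le> (\<integral>v. huber (2 ^ n * A) v \<partial>f (T - \<tau> (2 ^ n * A)))
      \<and> \<tau> (2 ^ n * A) \<le> T" for n
  proof (induction n)
    case (Suc n)
    have "1 * A \<le> 2 ^ n * A" using A0 by (intro mult_right_mono) auto
    moreover have "0 \<le> \<tau> (2 ^ n * A) - \<tau> (2 * (2 ^ n * A))" using \<tau>2[of "2 ^ n * A"] A0 c by simp
    ultimately show ?case using step[of "2 ^ n * A"] Suc by (simp add: mult.assoc)
  qed (use A in simp)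
  have "filterlim (\<lambda>n. (2 :: real) ^ n * A) at_top sequentially"
  proof (rule filterlim_at_top_mult_tendsto_pos[OF tendsto_const A0])
    show "filterlim (\<lambda>n. (2 :: real) ^ n) at_top sequentially"
      by (rule filterlim_at_top_mono[OF filterlim_real_sequentially])
        (auto intro!: always_eventually less_imp_le of_nat_less_two_power)
  qed
  then have "(\<lambda>n. (2 ^ n * A) powr (1 - \<gamma>) * M) \<longlonglongrightarrow> 0"
    using gamma by (intro tendsto_mult_left_zero tendsto_neg_powr) auto
  moreover have "(\<integral>v. huber A v \<partial>f (T - \<tau> A)) \<le> (2 ^ n * A) powr (1 - \<gamma>) * M" for n
    using A0 by (intro order_trans[OF conjunct1[OF grow[of n]] huber_moment_le]) simp
  ultimately have "(\<integral>v. huber A v \<partial>f (T - \<tau> A)) \<le> 0"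
    by (intro LIMSEQ_le_const[where X = "\<lambda>n. (2 ^ n * A) powr (1 - \<gamma>) * M"]) auto
  moreover have "0 < (\<integral>v. huber A v \<partial>f (T - \<tau> A))"
  proof -
    let ?t = "T - \<tau> A"
    obtain n where "A + 2 \<le> real n * x" using x0 reals_Archimedean3 by (meson less_eq_real_def)
    define z where "z = y + real n * x"
    have z: "A + 2 \<le> z" using \<open>A + 2 \<le> real n * x\<close> \<open>x < y\<close> x0 by (simp add: z_def)
    have "in_support (f ?t) z"
      unfolding z_def using A \<tau>0[OF A0] by (intro support_unbounded[OF x y \<open>x < y\<close>]) auto
    then have "0 < (\<integral>v. tent z (1 / 2) v \<partial>f ?t)"
      using z A0 by (simp add: in_support_def)
    also have "\<dots> \<le> (\<integral>v. huber A v \<partial>f ?t)"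
    proof (rule integral_mono)
      show "integrable (f ?t) (tent z (1 / 2))" "integrable (f ?t) (huber A)"
        using z A0 by (auto intro!: test_function_integrable tent_test_function huber_test_function)
      show "tent z (1 / 2) v \<le> huber A v" for v
      proof (cases "v \<le> z - 1 / 2")
        case False
        then have "huber A v = v - A - 1 / 2" using z by (intro huber_eq) simp
        then show ?thesis using False z tent_le[of "1 / 2" z v] by linarith
      qed (simp add: tent_eq_0)
    qed
    finally show ?thesis .
  qed
  ultimately show False by simp
qed

end

section \<open>Measures with at most one support point\<close>

lemma tent_Cc_pos: "r < x \<Longrightarrow> tent x r \<in> Cc_pos"
  unfolding Cc_pos_def
  by (auto simp: tent_eq_0 intro!: exI[of _ "{x - r..x + r}"]
      continuous_on_subset[OF lipschitz_on_continuous_on[OF tent_lipschitz]])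

lemma in_support_cong:
  assumes "\<And>\<phi>. \<phi> \<in> Cc_pos \<Longrightarrow> (\<integral>v. \<phi> v \<partial>\<mu>) = (\<integral>v. \<phi> v \<partial>\<nu>)"
  shows "in_support \<mu> x \<longleftrightarrow> in_support \<nu> x"
  using assms tent_Cc_pos by (auto simp: in_support_def)

lemma radon_pos_sets: "radon_pos \<mu> \<Longrightarrow> sets \<mu> = sets borel_pos"
  by (simp add: radon_pos_def)

lemma radon_pos_space: "radon_pos \<mu> \<Longrightarrow> space \<mu> = {0<..}"
  using sets_eq_imp_space_eq[OF radon_pos_sets] by (simp add: space_restrict_space)

text \<open>A nonnegative function with zero integral vanishes almost everywhere, and the tent is positive exactly
  on the open interval. Only intervals compactly contained in \<open>(0,\<infinity>)\<close> are used, where the tent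
  is integrable.\<close>

lemma null_interval_of_not_in_support:
  assumes \<mu>: "radon_pos \<mu>" and x: "0 < x" "\<not> in_support \<mu> x"
  obtains r where "0 < r" "r < x" "{x - r<..<x + r} \<in> null_sets \<mu>"
proof -
  note sets = radon_pos_sets[OF \<mu>] and space = radon_pos_space[OF \<mu>]
  obtain r where r: "0 < r" "r < x" "\<not> 0 < (\<integral>v. tent x r v \<partial>\<mu>)"
    using x by (auto simp: in_support_def)
  have in_sets: "B \<in> sets \<mu>" if "B \<in> sets borel" "B \<subseteq> {0<..}" for B
    using that by (simp add: sets sets_restrict_space_iff)
  have "tent x r \<in> borel_measurable borel"
    by (intro borel_measurable_continuous_onI lipschitz_on_continuous_on[OF tent_lipschitz])
  then have meas [measurable]: "tent x r \<in> borel_measurable \<mu>"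
    unfolding measurable_cong_sets[OF sets refl] by (rule measurable_restrict_space1)
  have "integrable \<mu> (tent x r)"
  proof (rule Bochner_Integration.integrable_bound)
    have "emeasure \<mu> {x - r..x + r} < \<infinity>"
      using \<mu> r unfolding radon_pos_def by (auto dest!: spec[of _ "{x - r..x + r}"])
    then show "integrable \<mu> (\<lambda>v. r * indicator {x - r..x + r} v)"
      using r by (intro integrable_mult_right integrable_real_indicator in_sets) auto
    show "AE v in \<mu>. norm (tent x r v) \<le> norm (r * indicator {x - r..x + r} v)"
      using r by (intro AE_I2) (auto simp: indicator_def tent_eq_0)
  qed (rule meas)
  moreover have "(\<integral>v. tent x r v \<partial>\<mu>) = 0"
    using r(3) Bochner_Integration.integral_nonneg[of \<mu> "tent x r"] by (simp add: less_le)
  ultimately have "AE v in \<mu>. tent x r v = 0"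
    by (simp add: integral_nonneg_eq_0_iff_AE)
  moreover have "{v \<in> space \<mu>. \<not> tent x r v = 0} = {x - r<..<x + r}"
    using r by (auto simp: tent_def space)
  moreover have S: "{x - r<..<x + r} \<in> sets \<mu>"
    using r by (intro in_sets) auto
  ultimately have "{x - r<..<x + r} \<in> null_sets \<mu>"
    using AE_iff_measurable[OF S, of "\<lambda>v. tent x r v = 0"] by (simp add: null_sets_def)
  then show ?thesis by (rule that[OF r(1,2)])
qed

text \<open>By the Lindeloef property, the complement of the support is a countable union of null intervals, so a
  measure with at most one support point \<open>V\<close> is concentrated on \<open>{V}\<close>.\<close>

lemma two_support_points:
  assumes \<mu>: "radon_pos \<mu>" and nonzero: "\<mu> \<noteq> null_measure borel_pos"
    and not_dirac: "\<not> (\<exists>M>0. \<exists>V>0. \<mu> = scale_measure (ennreal M) (dirac_pos V))"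
  obtains x y where "in_support \<mu> x" "in_support \<mu> y" "x < y"
proof (rule ccontr)
  assume neg: "\<not> thesis"
  note sets = radon_pos_sets[OF \<mu>] and space = radon_pos_space[OF \<mu>]
  note witness = that
  have unique: "x = y" if "in_support \<mu> x" "in_support \<mu> y" for x y
    using neg witness[of x y] witness[of y x] that by linarith
  then obtain V where V: "0 < V" "\<And>x. 0 < x \<Longrightarrow> x \<noteq> V \<Longrightarrow> \<not> in_support \<mu> x"
  proof (cases "\<exists>x. in_support \<mu> x")
    case True
    then obtain V where "in_support \<mu> V" by blast
    moreover from this have "0 < V" by (simp add: in_support_def)
    ultimately show ?thesis using that[of V] unique by blast
  next
    case False
    then show ?thesis using that[of 1] by auto
  qed
  define \<F> where "\<F> = {{x - r<..<x + r} | x r. 0 < r \<and> r < x \<and> {x - r<..<x + r} \<in> null_sets \<mu>}"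
  obtain \<F>' where F': "\<F>' \<subseteq> \<F>" "countable \<F>'" "\<Union>\<F>' = \<Union>\<F>"
    by (rule Lindelof[of \<F>]) (auto simp: \<F>_def)
  have "(\<Union>U\<in>\<F>'. U) \<in> null_sets \<mu>"
    using F'(1,2) by (intro null_sets_UN') (auto simp: \<F>_def)
  then have null: "\<Union>\<F> \<in> null_sets \<mu>" using F'(3) by simp
  have cover: "{0<..} - {V} \<subseteq> \<Union>\<F>"
  proof
    fix x assume "x \<in> {0<..} - {V}"
    then have x: "0 < x" "\<not> in_support \<mu> x" using V by auto
    obtain r where "0 < r" "r < x" "{x - r<..<x + r} \<in> null_sets \<mu>"
      using null_interval_of_not_in_support[OF \<mu> x] .
    moreover from this have "x \<in> {x - r<..<x + r}" by simp
    ultimately show "x \<in> \<Union>\<F>" unfolding \<F>_def by blast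
  qed
  have V_sets: "{V} \<in> sets \<mu>" using V(1) by (simp add: sets sets_restrict_space_iff)
  have em: "emeasure \<mu> B = emeasure \<mu> {V} * indicator B V" if B: "B \<in> sets \<mu>" for B
  proof -
    have "B \<subseteq> {0<..}" using sets.sets_into_space[OF B] space by simp
    then have "B - {V} \<in> null_sets \<mu>"
      using null_sets_subset[OF null, of "B - {V}"] cover B V_sets by auto
    moreover have "B = (B \<inter> {V}) \<union> (B - {V})" by blast
    ultimately have "emeasure \<mu> B = emeasure \<mu> (B \<inter> {V})"
      using emeasure_Un_null_set[of "B \<inter> {V}" \<mu> "B - {V}"] B V_sets by simp
    then show ?thesis by (cases "V \<in> B") auto
  qed
  have "emeasure \<mu> {V} < \<infinity>"
    using \<mu> V(1) by (simp add: radon_pos_def)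
  then obtain m where m: "emeasure \<mu> {V} = ennreal m" "0 \<le> m"
    by (cases "emeasure \<mu> {V}") auto
  show False
  proof (cases "m = 0")
    case True
    have "\<mu> = null_measure borel_pos"
      by (rule measure_eqI) (use em m True in \<open>auto simp: sets\<close>)
    then show False using nonzero by simp
  next
    case False
    have "\<mu> = scale_measure (ennreal m) (dirac_pos V)"
      by (rule measure_eqI) (use em m in \<open>auto simp: dirac_pos_def sets\<close>)
    then show False using not_dirac m False V(1) by (metis less_eq_real_def)
  qed
qed

section \<open>From kernel and weak solution to the flow\<close>

text \<open>Continuity of \<open>h\<close> and \<open>g\<close> is given on closed sets only; composing with \<open>max _ 0\<close> extends both
  factors continuously.\<close>

lemma kernel_assumption_measurable:
  assumes "kernel_assumption \<gamma> K"
  shows "(\<lambda>z. K (fst z) (snd z)) \<in> borel_measurable (borel_pos \<Otimes>\<^sub>M borel_pos)"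
proof -
  obtain h g where K: "\<And>v w. 0 \<le> v \<Longrightarrow> 0 \<le> w \<Longrightarrow> K v w = h v w * g (v / (v + w))"
    and g: "continuous_on {0..} g" and h: "continuous_on ({0..} \<times> {0..}) (\<lambda>(v, w). h v w)"
    using assms unfolding kernel_assumption_def by metis
  have "continuous_on UNIV (\<lambda>z :: real \<times> real. (\<lambda>(v, w). h v w) (max (fst z) 0, max (snd z) 0))"
    by (rule continuous_on_compose2[OF h]) (auto intro!: continuous_intros)
  then have h' [measurable]: "(\<lambda>z :: real \<times> real. h (max (fst z) 0) (max (snd z) 0)) \<in> borel_measurable borel"
    by (intro borel_measurable_continuous_onI) simp
  have "continuous_on UNIV (\<lambda>x :: real. g (max x 0))"
    by (rule continuous_on_compose2[OF g]) (auto intro!: continuous_intros)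
  then have g' [measurable]: "(\<lambda>x. g (max x 0)) \<in> borel_measurable borel"
    by (rule borel_measurable_continuous_onI)
  have q: "(\<lambda>z :: real \<times> real. fst z / (fst z + snd z)) \<in> borel_measurable borel"
    unfolding borel_prod[symmetric] by measurable
  have "(\<lambda>z :: real \<times> real. h (max (fst z) 0) (max (snd z) 0) * g (max (fst z / (fst z + snd z)) 0))
      \<in> borel_measurable borel"
    using measurable_compose[OF q g'] by measurable
  moreover have "(\<lambda>z. (fst z, snd z)) \<in> measurable (borel_pos \<Otimes>\<^sub>M borel_pos) (borel :: (real \<times> real) measure)"
    unfolding borel_prod[symmetric]
    by (intro measurable_Pair measurable_compose[OF measurable_fst] measurable_compose[OF measurable_snd]
        measurable_restrict_space1) simp_all
  ultimately have "(\<lambda>z. h (max (fst z) 0) (max (snd z) 0) * g (max (fst z / (fst z + snd z)) 0))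
      \<in> borel_measurable (borel_pos \<Otimes>\<^sub>M borel_pos)"
    by (auto dest: measurable_compose[rotated])
  then show ?thesis
    by (subst measurable_cong[where g = "\<lambda>z. h (max (fst z) 0) (max (snd z) 0) * g (max (fst z / (fst z + snd z)) 0)"])
      (auto simp: space_pair_measure space_restrict_space K)
qed

text \<open>If \<open>3 w \<le> v\<close> then \<open>v / (v + w) \<ge> 3 / 4\<close>, at distance at least \<open>1 / 4\<close> from the zero of \<open>g\<close>; this gives the
  lower bound for large \<open>v\<close>. For \<open>v\<close> near \<open>x\<close> and \<open>w\<close> near \<open>y \<noteq> x\<close> the distance to \<open>1 / 2\<close> is at least
  \<open>\<bar>x - y\<bar> / (8 (x + y))\<close>.\<close>

lemma kernel_assumption_bounds:
  assumes "kernel_assumption \<gamma> K"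
  obtains C \<kappa> H where "0 \<le> C" "0 < \<kappa>" "0 < H"
    and "\<And>v w. 0 < v \<Longrightarrow> 0 < w \<Longrightarrow> K v w \<le> C * (v powr \<gamma> + w powr \<gamma>)"
    and "\<And>v w. H \<le> v \<Longrightarrow> 0 < w \<Longrightarrow> 3 * w \<le> v \<Longrightarrow> \<kappa> * v powr \<gamma> \<le> K v w"
    and "\<And>x y. 0 < x \<Longrightarrow> 0 < y \<Longrightarrow> x \<noteq> y \<Longrightarrow> \<exists>\<rho>>0. \<exists>c>0. \<rho> < x \<and> \<rho> < y \<and>
        (\<forall>v\<in>{x - \<rho>..x + \<rho>}. \<forall>w\<in>{y - \<rho>..y + \<rho>}. c \<le> K v w)"
proof -
  obtain h g
    where K0: "\<forall>v\<ge>0. \<forall>w\<ge>0. K v w = h v w * g (v / (v + w))"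
    and h_ge: "\<exists>H>1. \<exists>H0>0. \<forall>v\<ge>0. \<forall>w\<ge>0. v + w > H \<longrightarrow> H0 * (v powr \<gamma> + w powr \<gamma>) \<le> h v w"
    and loc0: "\<forall>R>0. \<exists>C>0. \<forall>v\<in>{1 / R..R}. \<forall>w\<in>{1 / R..R}. C \<le> h v w"
    and h_le: "\<exists>H1>0. \<forall>v\<ge>0. \<forall>w\<ge>0. h v w \<le> H1 * (v powr \<gamma> + w powr \<gamma>)"
    and g_bounds: "\<exists>G0>0. \<exists>G1>0. \<exists>k\<ge>1. \<forall>x\<in>{0..1}. G0 * \<bar>x - 1 / 2\<bar> powr k \<le> g x \<and> g x \<le> G1"
    using assms unfolding kernel_assumption_def
    by - (drule conjunct2, erule exE, erule exE, (erule conjE)+, rule that, assumption+)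
  have K: "K v w = h v w * g (v / (v + w))" if "0 \<le> v" "0 \<le> w" for v w
    using K0 that by blast
  have loc: "\<exists>c>0. \<forall>v\<in>{1 / R..R}. \<forall>w\<in>{1 / R..R}. c \<le> h v w" if "0 < R" for R
    using loc0 that by blast
  obtain H H0 where H: "1 < H" "0 < H0"
      "\<And>v w. 0 \<le> v \<Longrightarrow> 0 \<le> w \<Longrightarrow> H < v + w \<Longrightarrow> H0 * (v powr \<gamma> + w powr \<gamma>) \<le> h v w"
    using h_ge by blast
  obtain H1 where H1: "0 < H1" "\<And>v w. 0 \<le> v \<Longrightarrow> 0 \<le> w \<Longrightarrow> h v w \<le> H1 * (v powr \<gamma> + w powr \<gamma>)"
    using h_le by blast
  obtain G0 G1 k :: real where G: "0 < G0" "0 < G1" "1 \<le> k"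
      "\<And>x. x \<in> {0..1} \<Longrightarrow> G0 * \<bar>x - 1 / 2\<bar> powr k \<le> g x"
      "\<And>x. x \<in> {0..1} \<Longrightarrow> g x \<le> G1"
    using g_bounds by blast
  have frac: "v / (v + w) \<in> {0..1}" if "0 < v" "0 < w" for v w :: real
    using that by (auto simp: field_simps)
  have g_ge: "G0 * \<delta> powr k \<le> g (v / (v + w))"
    if "0 < v" "0 < w" "0 \<le> \<delta>" "\<delta> \<le> \<bar>v / (v + w) - 1 / 2\<bar>" for v w \<delta>
  proof -
    have "G0 * \<delta> powr k \<le> G0 * \<bar>v / (v + w) - 1 / 2\<bar> powr k"
      using G that by (intro mult_left_mono powr_mono2) auto
    also have "\<dots> \<le> g (v / (v + w))" using G(4) frac that by blast
    finally show ?thesis .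
  qed
  show ?thesis
  proof (rule that[of "H1 * G1" "H0 * (G0 * (1 / 4) powr k)" H])
    fix v w :: real assume vw: "0 < v" "0 < w"
    have "0 \<le> g (v / (v + w))"
      using g_ge[OF vw, of 0] G by simp
    then have "K v w \<le> (H1 * (v powr \<gamma> + w powr \<gamma>)) * g (v / (v + w))"
      unfolding K[OF less_imp_le[OF vw(1)] less_imp_le[OF vw(2)]]
      using H1(2)[of v w] vw by (intro mult_right_mono) auto
    also have "\<dots> \<le> (H1 * (v powr \<gamma> + w powr \<gamma>)) * G1"
      using G(5)[OF frac[OF vw]] H1(1) by (intro mult_left_mono) auto
    finally show "K v w \<le> H1 * G1 * (v powr \<gamma> + w powr \<gamma>)" by (simp add: mult_ac)
  next
    fix v w :: real assume vw: "H \<le> v" "0 < w" "3 * w \<le> v"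
    have v: "0 < v" using vw H by linarith
    have "1 / 4 \<le> v / (v + w) - 1 / 2" using vw v by (simp add: field_simps)
    then have g: "G0 * (1 / 4) powr k \<le> g (v / (v + w))"
      using v vw by (intro g_ge) auto
    have "H0 * v powr \<gamma> \<le> H0 * (v powr \<gamma> + w powr \<gamma>)" using H by simp
    also have "\<dots> \<le> h v w" using v vw by (intro H) auto
    finally have "(H0 * v powr \<gamma>) * (G0 * (1 / 4) powr k) \<le> h v w * g (v / (v + w))"
      using g H G by (intro mult_mono) (auto intro: order_trans[rotated])
    then show "H0 * (G0 * (1 / 4) powr k) * v powr \<gamma> \<le> K v w"
      using K[of v w] v vw by (simp add: mult_ac)
  next
    fix x y :: real assume xy: "0 < x" "0 < y" "x \<noteq> y"
    define \<rho> where "\<rho> = min (\<bar>x - y\<bar> / 4) (min x y / 2)"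
    \<comment> \<open>Large enough for \<open>[1 / R, R]\<close> to contain both \<open>\<rho>\<close>-neighbourhoods.\<close>
    define R where "R = 2 * (x + y) + 2 / x + 2 / y"
    define \<delta> where "\<delta> = \<bar>x - y\<bar> / (8 * (x + y))"
    have \<rho>: "0 < \<rho>" "\<rho> \<le> x / 2" "\<rho> \<le> y / 2" "4 * \<rho> \<le> \<bar>x - y\<bar>"
      using xy min.cobounded1[of "\<bar>x - y\<bar> / 4" "min x y / 2"] by (auto simp: \<rho>_def)
    have R: "0 < R" using xy by (simp add: R_def add_pos_pos)
    have "1 / R \<le> x / 2" "1 / R \<le> y / 2"
    proof -
      have "2 / x \<le> R" "2 / y \<le> R" using xy by (auto simp: R_def)
      then show "1 / R \<le> x / 2" "1 / R \<le> y / 2" using xy R by (auto simp: field_simps)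
    qed
    moreover have "2 * (x + y) \<le> R" using xy by (simp add: R_def)
    ultimately have in_R: "v \<in> {1 / R..R}" "w \<in> {1 / R..R}"
      if "v \<in> {x - \<rho>..x + \<rho>}" "w \<in> {y - \<rho>..y + \<rho>}" for v w
      using that \<rho> xy by auto
    obtain c where c: "0 < c" "\<And>v w. v \<in> {1 / R..R} \<Longrightarrow> w \<in> {1 / R..R} \<Longrightarrow> c \<le> h v w"
      using loc[OF R] by blast
    have \<delta>: "0 < \<delta>" using xy by (simp add: \<delta>_def)
    have "c * (G0 * \<delta> powr k) \<le> K v w"
      if vw: "v \<in> {x - \<rho>..x + \<rho>}" "w \<in> {y - \<rho>..y + \<rho>}" for v w
    proof -
      have pos: "0 < v" "0 < w" using vw \<rho> xy by auto
      have diff: "\<bar>x - y\<bar> / 2 \<le> \<bar>v - w\<bar>"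
        using vw \<rho>(4) by (auto simp: abs_real_def split: if_splits)
      have sum: "v + w \<le> 2 * (x + y)" using vw \<rho> xy by auto
      have "\<delta> = (\<bar>x - y\<bar> / 2) / (2 * (2 * (x + y)))" by (simp add: \<delta>_def)
      also have "\<dots> \<le> \<bar>v - w\<bar> / (2 * (v + w))"
        using diff sum pos by (intro frac_le) auto
      also have "\<dots> = \<bar>(v - w) / (2 * (v + w))\<bar>" using pos by (simp add: abs_divide)
      also have "(v - w) / (2 * (v + w)) = v / (v + w) - 1 / 2"
        using pos by (simp add: field_simps)
      finally have "G0 * \<delta> powr k \<le> g (v / (v + w))"
        using \<delta> pos by (intro g_ge) auto
      moreover have "c \<le> h v w" using c(2) in_R[OF vw] by blast
      ultimately show ?thesis
        using K[of v w] pos c(1) G(1) by (auto intro!: mult_mono)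
    qed
    moreover have "0 < c * (G0 * \<delta> powr k)" using c G \<delta> by simp
    moreover have "\<rho> < x" "\<rho> < y" using \<rho> xy by auto
    ultimately show "\<exists>\<rho>>0. \<exists>c>0. \<rho> < x \<and> \<rho> < y \<and>
        (\<forall>v\<in>{x - \<rho>..x + \<rho>}. \<forall>w\<in>{y - \<rho>..y + \<rho>}. c \<le> K v w)"
      using \<rho>(1) by blast
  qed (use H G H1 in auto)
qed

lemma set_integral_singleton: "(LINT s:{a..a}|lborel. Q s) = 0" for Q :: "real \<Rightarrow> real"
  unfolding set_lebesgue_integral_def
  by (rule integral_eq_zero_AE)
    (use AE_lborel_singleton[of a] in \<open>auto elim!: eventually_mono\<close>)

text \<open>The solution is extended to all real times by its values at the endpoints of \<open>[0,\<tau>]\<close>. At time \<open>0\<close> the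
  weak equation identifies the integrals against \<open>f 0\<close> with those against the initial datum.\<close>

lemma weak_solution_clamped_flow:
  assumes "1 < \<gamma>" and K: "kernel_assumption \<gamma> K" and sol: "weak_solution \<gamma> K T f_in f"
    and \<tau>: "0 < \<tau>" "ereal \<tau> \<le> T"
  obtains C \<kappa> H M where "coagulation_flow \<gamma> C \<kappa> H M \<tau> K (\<lambda>t. f (max 0 (min \<tau> t)))"
proof -
  obtain C \<kappa> H where C: "0 \<le> C" "0 < \<kappa>" "0 < H"
    "\<And>v w. 0 < v \<Longrightarrow> 0 < w \<Longrightarrow> K v w \<le> C * (v powr \<gamma> + w powr \<gamma>)"
    "\<And>v w. H \<le> v \<Longrightarrow> 0 < w \<Longrightarrow> 3 * w \<le> v \<Longrightarrow> \<kappa> * v powr \<gamma> \<le> K v w"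
    "\<And>x y. 0 < x \<Longrightarrow> 0 < y \<Longrightarrow> x \<noteq> y \<Longrightarrow> \<exists>\<rho>>0. \<exists>c>0. \<rho> < x \<and> \<rho> < y \<and>
        (\<forall>v\<in>{x - \<rho>..x + \<rho>}. \<forall>w\<in>{y - \<rho>..y + \<rho>}. c \<le> K v w)"
    by (rule kernel_assumption_bounds[OF K], rule that; assumption)
  define clamp where "clamp t = max 0 (min \<tau> t)" for t
  have clamp_in: "clamp t \<in> time_interval T" for t
    using \<tau> by (auto simp: clamp_def time_interval_def intro: order_trans[rotated])
  have clamp_id: "clamp t = t" if "t \<in> {0..\<tau>}" for t using that by (auto simp: clamp_def)
  define S where "S = (SUP t\<in>time_interval T. \<integral>\<^sup>+v. ennreal (1 + v powr \<gamma>) \<partial>f t)"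
  have "S < \<infinity>" using sol unfolding weak_solution_def S_def by blast
  then obtain M where M: "S = ennreal M" "0 \<le> M" by (cases S) auto
  have moment: "(\<integral>\<^sup>+v. ennreal (1 + v powr \<gamma>) \<partial>f (clamp t)) \<le> ennreal (M + 1)" for t
  proof -
    have "(\<integral>\<^sup>+v. ennreal (1 + v powr \<gamma>) \<partial>f (clamp t)) \<le> S"
      unfolding S_def by (rule SUP_upper) (rule clamp_in)
    also have "\<dots> \<le> ennreal (M + 1)" using M by (simp add: ennreal_leI)
    finally show ?thesis .
  qed
  have flow: "coagulation_flow \<gamma> C \<kappa> H (M + 1) \<tau> K (\<lambda>t. f (clamp t))"
  proof
    show "K v w \<ge> 0" if "0 < v" "0 < w" for v w
      using K that by (auto simp: kernel_assumption_def)
    show "sets (f (clamp t)) = sets borel_pos" for t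
      using sol clamp_in[of t]
      by (auto simp: weak_solution_def radon_pos_weighted_def radon_pos_def)
    show "continuous_on UNIV (\<lambda>t. \<integral>v. \<phi> v \<partial>f (clamp t))" if "\<phi> \<in> Cc_pos" for \<phi>
    proof (rule continuous_on_compose2[where g = "\<lambda>t. \<integral>v. \<phi> v \<partial>f t"])
      show "continuous_on (time_interval T) (\<lambda>t. \<integral>v. \<phi> v \<partial>f t)"
        using sol that by (simp add: weak_solution_def)
      show "continuous_on UNIV clamp"
        unfolding clamp_def by (intro continuous_intros)
    qed (use clamp_in in auto)
    fix \<phi> t assume \<phi>: "\<phi> \<in> Cc_pos" and t: "t \<in> {0..\<tau>}"
    define Q where "Q s = (\<integral>w. (\<integral>v. K v w * (\<phi> (v + w) - \<phi> v - \<phi> w) \<partial>f s) \<partial>f s)" for s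
    have weak: "(\<integral>v. \<phi> v \<partial>f s) - (\<integral>v. \<phi> v \<partial>f_in) = 1 / 2 * (LINT s:{0..s}|lborel. Q s)"
      if "s \<in> {0..\<tau>}" for s
      using sol \<phi> clamp_in[of s] clamp_id[OF that] by (simp add: weak_solution_def Q_def)
    have "(LINT s:{0..0}|lborel. Q s) = 0"
      by (rule set_integral_singleton)
    moreover have "(LINT s:{0..t}|lborel. Q s) = (LINT s:{0..t}|lborel. Q (clamp s))"
      by (rule set_lebesgue_integral_cong) (use t clamp_id in auto)
    ultimately show "(\<integral>v. \<phi> v \<partial>f (clamp t)) - (\<integral>v. \<phi> v \<partial>f (clamp 0)) = 1 / 2 * (LINT s:{0..t}|lborel.
        (\<integral>w. (\<integral>v. K v w * (\<phi> (v + w) - \<phi> v - \<phi> w) \<partial>f (clamp s)) \<partial>f (clamp s)))"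
      using weak[OF t] weak[of 0] t \<tau> clamp_id[OF t] clamp_id[of 0] by (simp add: Q_def)
  qed (use assms C M moment kernel_assumption_measurable[OF K] in auto)
  then show ?thesis using that unfolding clamp_def by blast
qed

theorem theorem1p6:
  fixes \<gamma> :: real and K :: "real \<Rightarrow> real \<Rightarrow> real" and f_in :: "real measure"
  assumes "\<gamma> > 1"
    and "kernel_assumption \<gamma> K"
    and "radon_pos f_in"
    and "f_in \<noteq> null_measure borel_pos"
    and "\<not> (\<exists>M>0. \<exists>V>0. f_in = scale_measure (ennreal M) (dirac_pos V))"
  shows "\<not> (\<exists>T::ereal. T > 0 \<and> (\<exists>f. mass_conserving_solution \<gamma> K T f_in f))"
proof
  assume "\<exists>T::ereal. T > 0 \<and> (\<exists>f. mass_conserving_solution \<gamma> K T f_in f)"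
  then obtain T f where T: "(0 :: ereal) < T" and sol: "weak_solution \<gamma> K T f_in f"
    by (auto simp: mass_conserving_solution_def)
  obtain \<tau> where \<tau>: "0 < \<tau>" "ereal \<tau> \<le> T"
    using T ereal_dense2[of 0 T] by (auto intro: less_imp_le)
  obtain C \<kappa> H M where "coagulation_flow \<gamma> C \<kappa> H M \<tau> K (\<lambda>t. f (max 0 (min \<tau> t)))"
    using weak_solution_clamped_flow[OF assms(1,2) sol \<tau>] .
  then interpret coagulation_flow \<gamma> C \<kappa> H M \<tau> K "\<lambda>t. f (max 0 (min \<tau> t))" .
  have "0 \<in> time_interval T" using T by (simp add: time_interval_def zero_ereal_def[symmetric])
  moreover have "(LINT s:{0..0}|lborel. Q s) = 0" for Q :: "real \<Rightarrow> real"
    by (rule set_integral_singleton)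
  ultimately have "(\<integral>v. \<phi> v \<partial>f_in) = (\<integral>v. \<phi> v \<partial>f 0)" if "\<phi> \<in> Cc_pos" for \<phi>
    using sol that by (fastforce simp: weak_solution_def)
  then have "in_support f_in x \<longleftrightarrow> in_support (f 0) x" for x
    by (rule in_support_cong)
  moreover obtain x y where "in_support f_in x" "in_support f_in y" "x < y"
    using two_support_points[OF assms(3-5)] .
  ultimately show False
    using at_most_one_support_point[of x y] \<tau> by simp
qed

end
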